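(* $\mathsf{ZP}_\tau\mathsf{CSPACE}[s,c]\subseteq\mathsf{AVG}_\tau\text{-}\mathsf{LCSPACE}[O(s),O(c\log c),o(1)]$.
   Context: Throughout, $n$ is the input length and $s=s(n)$, $c=c(n)$ are non-decreasing logspace-constructible functions with $s\ge\log n$, $s\le c\le 2^s$. A catalytic-type machine has a read-only input tape, a write-only output tape, a read-write work tape and a read-write catalytic tape initially holding an arbitrary string $\tau$. $L\in\mathsf{ZP}_\tau\mathsf{CSPACE}[s,c]$ if some deterministic such machine with work space $s$ and catalytic space $c$ always halts with its initial catalytic content $\tau$ restored, and on every input $x$ outputs either $L(x)$ or a special symbol $\perp$ (never the wrong answer), outputting $L(x)$ for at least half of all initial tapes $\tau\in\{0,1\}^c$. Let $d$ denote Hamming distance. For functions $s',c',e$, $L\in\mathsf{AVG}_\tau\text{-}\mathsf{LCSPACE}[s',c',e]$ if some deterministic such machine with work space $s'$ and catalytic space $c'$ outputs $L(x)$ on every input $x$ and every initial $\tau\in\{0,1\}^{c'}$, and, writing $\tau'$ for its final catalytic content, $\mathbb{E}_\tau[d(\tau,\tau')]\le e$ for $\tau$ uniform in $\{0,1\}^{c'}$. *)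

theory Defs
  imports Complex_Main "HOL-Library.Landau_Symbols"
begin

text \<open>Head moves and output symbols.  The output tape is write-only (append-only);
  a decision machine writes a single symbol O0, O1 or Bot (the special symbol).\<close>

datatype dir = Lft | Stay | Rgt

datatype out = O0 | O1 | Bot

text \<open>A deterministic machine with finitely many states 0..<nst (start state 0),
  a set of halting states, and a transition function reading the input symbol
  (None = endmarker), the work bit and the catalytic bit; it returns the new state,
  the bits written on the work and catalytic tapes, the three head moves
  (input, work, catalytic) and possibly an output symbol to append.\<close>

record mach =
  nst :: nat
  hlt :: "nat \<Rightarrow> bool"
  dlt :: "nat \<Rightarrow> bool option \<Rightarrow> bool \<Rightarrow> bool \<Rightarrow>
          nat \<times> bool \<times> bool \<times> dir \<times> dir \<times> dir \<times> out option"

definition wf_mach :: "mach \<Rightarrow> bool" where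
  "wf_mach M \<longleftrightarrow> 0 < nst M \<and>
     (\<forall>q i a b. q < nst M \<longrightarrow> fst (dlt M q i a b) < nst M)"

record conf =
  st :: nat
  ih :: nat
  wt :: "bool list"
  wh :: nat
  ct :: "bool list"
  ch :: nat
  ot :: "out list"

text \<open>Input tape: positions 0 and n+1 hold endmarkers, position i (1..n) holds x!(i-1).\<close>
definition inp :: "bool list \<Rightarrow> nat \<Rightarrow> bool option" where
  "inp x i = (if 1 \<le> i \<and> i \<le> length x then Some (x ! (i - 1)) else None)"

definition rd :: "bool list \<Rightarrow> nat \<Rightarrow> bool" where
  "rd t h = (if h < length t then t ! h else False)"

fun mv :: "dir \<Rightarrow> nat \<Rightarrow> nat \<Rightarrow> nat" where
  "mv Lft h hi = h - 1"
| "mv Stay h hi = min h hi"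
| "mv Rgt h hi = min (Suc h) hi"

definition step :: "mach \<Rightarrow> bool list \<Rightarrow> conf \<Rightarrow> conf" where
  "step M x C =
    (if hlt M (st C) then C else
     (case dlt M (st C) (inp x (ih C)) (rd (wt C) (wh C)) (rd (ct C) (ch C)) of
       (q', wb, cb, di, dw, dc, oo) \<Rightarrow>
         C\<lparr> st := q',
            ih := mv di (ih C) (length x + 1),
            wt := (wt C)[wh C := wb],
            wh := mv dw (wh C) (length (wt C) - 1),
            ct := (ct C)[ch C := cb],
            ch := mv dc (ch C) (length (ct C) - 1),
            ot := ot C @ (case oo of None \<Rightarrow> [] | Some sy \<Rightarrow> [sy]) \<rparr>))"

definition init :: "bool list \<Rightarrow> nat \<Rightarrow> bool list \<Rightarrow> conf" where
  "init x w \<tau> = \<lparr> st = 0, ih = 0, wt = replicate w False, wh = 0,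
                  ct = \<tau>, ch = 0, ot = [] \<rparr>"

definition halts :: "mach \<Rightarrow> bool list \<Rightarrow> nat \<Rightarrow> bool list \<Rightarrow> bool" where
  "halts M x w \<tau> \<longleftrightarrow> (\<exists>t. hlt M (st ((step M x ^^ t) (init x w \<tau>))))"

definition final :: "mach \<Rightarrow> bool list \<Rightarrow> nat \<Rightarrow> bool list \<Rightarrow> conf" where
  "final M x w \<tau> =
     (step M x ^^ (LEAST t. hlt M (st ((step M x ^^ t) (init x w \<tau>))))) (init x w \<tau>)"

definition dec :: "bool \<Rightarrow> out" where
  "dec b = (if b then O1 else O0)"

definition hamming :: "bool list \<Rightarrow> bool list \<Rightarrow> nat" where
  "hamming a b = card {i. i < length a \<and> a ! i \<noteq> b ! i}"

text \<open>Languages are predicates on binary strings.  Work space s(n) = number of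
  (binary) work-tape cells, catalytic space c(n) = number of catalytic cells.\<close>

definition ZP_CSPACE :: "(nat \<Rightarrow> nat) \<Rightarrow> (nat \<Rightarrow> nat) \<Rightarrow> (bool list \<Rightarrow> bool) set" where
  "ZP_CSPACE s c = {L. \<exists>M. wf_mach M \<and>
     (\<forall>x \<tau>. length \<tau> = c (length x) \<longrightarrow>
        halts M x (s (length x)) \<tau> \<and>
        ct (final M x (s (length x)) \<tau>) = \<tau> \<and>
        ot (final M x (s (length x)) \<tau>) \<in> {[dec (L x)], [Bot]}) \<and>
     (\<forall>x. 2 ^ c (length x) \<le>
        2 * card {\<tau>. length \<tau> = c (length x) \<and>
                     ot (final M x (s (length x)) \<tau>) = [dec (L x)]})}"

definition AVG_LCSPACE ::
  "(nat \<Rightarrow> nat) \<Rightarrow> (nat \<Rightarrow> nat) \<Rightarrow> (nat \<Rightarrow> real) \<Rightarrow> (bool list \<Rightarrow> bool) set" where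
  "AVG_LCSPACE s c e = {L. \<exists>M. wf_mach M \<and>
     (\<forall>x \<tau>. length \<tau> = c (length x) \<longrightarrow>
        halts M x (s (length x)) \<tau> \<and>
        ot (final M x (s (length x)) \<tau>) = [dec (L x)]) \<and>
     (\<forall>x. (\<Sum>\<tau>\<in>{\<tau>. length \<tau> = c (length x)}.
             real (hamming \<tau> (ct (final M x (s (length x)) \<tau>))))
           / 2 ^ c (length x) \<le> e (length x))}"

definition bits_val :: "out list \<Rightarrow> nat" where
  "bits_val w = foldl (\<lambda>a b. 2 * a + (if b = O1 then 1 else 0)) 0 w"

definition logspace_constructible :: "(nat \<Rightarrow> nat) \<Rightarrow> bool" where
  "logspace_constructible f \<longleftrightarrow> (\<exists>M K. wf_mach M \<and>
     (\<forall>n. let x = replicate n True; w = K * nat \<lceil>log 2 (real n + 2)\<rceil> in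
        halts M x w [] \<and> set (ot (final M x w [])) \<subseteq> {O0, O1} \<and>
        bits_val (ot (final M x w [])) = f n))"

end

theory Submission
  imports Defs
begin

text \<open>
  Let \<open>k\<close> be the least positive number with \<open>c * k < 2 ^ k\<close>, so that \<open>k = O(log c)\<close>. The new
  catalytic tape has \<open>c * k\<close> cells and interleaves \<open>k\<close> independent strings of length \<open>c\<close>: the
  \<open>p\<close>-th cell of column \<open>j\<close> is cell \<open>p * k + j\<close>. The machine runs the zero-error machine on one
  column after the other until it gets an answer; every run restores the tape. All columns fail
  with probability at most \<open>2 ^ - k\<close>, and then the last column is used as a binary counter until it
  holds a good string. This costs at most \<open>c\<close> changed cells, hence at most \<open>c / 2 ^ k < 1 / k\<close> in
  expectation.

  No bound has to be computed from \<open>n\<close>. Heads are clamped at the ends of their tapes, and from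
  cell \<open>p * k\<close> the moves of the simulated head are \<open>2 * k - 1\<close> steps right and \<open>k - 1\<close> steps left,
  or \<open>k\<close> steps left: clamping on the interleaved tape then reproduces clamping on a single column.
  The number \<open>k\<close> is the length in binary of the length of the catalytic tape, which the machine
  finds by walking to its end while counting on the work tape.
\<close>

text \<open>
  A work tape of seven interleaved tracks: \<open>tA\<close> the simulated work tape, \<open>tO\<close> and \<open>tE\<close> the first
  and the last row, \<open>tU\<close> the number of columns in unary, \<open>tB\<close> a binary counter, \<open>tJ\<close> the current
  column, \<open>tH\<close> the parked position of the simulated work head.
\<close>

record row =
  tA :: bool
  tO :: bool
  tE :: bool
  tU :: bool
  tB :: bool
  tJ :: bool
  tH :: bool

definition enc_row :: "row \<Rightarrow> bool list" where
  "enc_row w = [tA w, tO w, tE w, tU w, tB w, tJ w, tH w]"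

definition dec_row :: "bool list \<Rightarrow> row" where
  "dec_row l = \<lparr>tA = l ! 0, tO = l ! 1, tE = l ! 2, tU = l ! 3, tB = l ! 4, tJ = l ! 5, tH = l ! 6\<rparr>"

definition blank_row :: row where
  "blank_row = \<lparr>tA = False, tO = False, tE = False, tU = False, tB = False, tJ = False, tH = False\<rparr>"

definition ntracks :: nat where "ntracks = 7"

lemma dec_enc_row [simp]: "dec_row (enc_row w) = w"
  by (simp add: dec_row_def enc_row_def)

lemma length_enc_row [simp]: "length (enc_row w) = ntracks"
  by (simp add: enc_row_def ntracks_def)

lemma ntracks_pos [simp]: "0 < ntracks"
  by (simp add: ntracks_def)

lemma enc_blank_row: "i < ntracks \<Longrightarrow> enc_row blank_row ! i = False"
  by (auto simp: enc_row_def blank_row_def ntracks_def less_Suc_eq numeral_eq_Suc)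

type_synonym 'r action = "'r \<times> row \<times> bool \<times> dir \<times> dir \<times> dir \<times> out option"

datatype 'r prog =
    Prim "'r \<Rightarrow> bool option \<Rightarrow> row \<Rightarrow> bool \<Rightarrow> 'r action"
  | Seq "'r prog" "'r prog" (infixr ";;" 60)
  | While "'r \<Rightarrow> bool option \<Rightarrow> row \<Rightarrow> bool \<Rightarrow> bool" "'r prog"
  | Cond "'r \<Rightarrow> bool option \<Rightarrow> row \<Rightarrow> bool \<Rightarrow> bool" "'r prog" "'r prog"

datatype 'r state = St 'r nat "row list" nat "bool list" nat "out list"

fun act :: "bool list \<Rightarrow> ('r \<Rightarrow> bool option \<Rightarrow> row \<Rightarrow> bool \<Rightarrow> 'r action) \<Rightarrow> 'r state \<Rightarrow> 'r state" where
  "act x f (St r i W h C k y) = (case f r (inp x i) (W ! h) (rd C k) of (r', w, b, di, dw, dc, oo) \<Rightarrow>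
     St r' (mv di i (length x + 1)) (W[h := w]) (mv dw h (length W - 1)) (C[k := b])
       (mv dc k (length C - 1)) (y @ (case oo of None \<Rightarrow> [] | Some sy \<Rightarrow> [sy])))"

fun test :: "bool list \<Rightarrow> ('r \<Rightarrow> bool option \<Rightarrow> row \<Rightarrow> bool \<Rightarrow> bool) \<Rightarrow> 'r state \<Rightarrow> bool" where
  "test x b (St r i W h C k y) = b r (inp x i) (W ! h) (rd C k)"

inductive exec :: "bool list \<Rightarrow> 'r prog \<Rightarrow> 'r state \<Rightarrow> 'r state \<Rightarrow> bool" for x where
  exec_Prim: "act x f S = S' \<Longrightarrow> exec x (Prim f) S S'"
| exec_Seq: "exec x p S S' \<Longrightarrow> exec x q S' S'' \<Longrightarrow> exec x (p ;; q) S S''"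
| exec_WhileF: "\<not> test x b S \<Longrightarrow> exec x (While b p) S S"
| exec_WhileT: "test x b S \<Longrightarrow> exec x p S S' \<Longrightarrow> exec x (While b p) S' S'' \<Longrightarrow> exec x (While b p) S S''"
| exec_IfT: "test x b S \<Longrightarrow> exec x p S S' \<Longrightarrow> exec x (Cond b p q) S S'"
| exec_IfF: "\<not> test x b S \<Longrightarrow> exec x q S S' \<Longrightarrow> exec x (Cond b p q) S S'"

section \<open>Small steps with an explicit stack\<close>

fun delta :: "'r prog list \<Rightarrow> 'r \<Rightarrow> bool option \<Rightarrow> row \<Rightarrow> bool \<Rightarrow> ('r prog list \<times> 'r) \<times> row \<times> bool \<times> dir \<times> dir \<times> dir \<times> out option" where
  "delta [] r i w b = (([], r), w, b, Stay, Stay, Stay, None)"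
| "delta (Prim f # K) r i w b = (case f r i w b of (r', rest) \<Rightarrow> ((K, r'), rest))"
| "delta ((p ;; q) # K) r i w b = ((p # q # K, r), w, b, Stay, Stay, Stay, None)"
| "delta (While t p # K) r i w b = ((if t r i w b then p # While t p # K else K, r), w, b, Stay, Stay, Stay, None)"
| "delta (Cond t p q # K) r i w b = ((if t r i w b then p # K else q # K, r), w, b, Stay, Stay, Stay, None)"

fun small :: "bool list \<Rightarrow> 'r prog list \<times> 'r state \<Rightarrow> 'r prog list \<times> 'r state" where
  "small x (K, St r i W h C k y) = (case delta K r (inp x i) (W ! h) (rd C k) of
     ((K', r'), w, b, di, dw, dc, oo) \<Rightarrow>
       (K', St r' (mv di i (length x + 1)) (W[h := w]) (mv dw h (length W - 1)) (C[k := b])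
       (mv dc k (length C - 1)) (y @ (case oo of None \<Rightarrow> [] | Some sy \<Rightarrow> [sy]))))"

fun in_range :: "bool list \<Rightarrow> 'r state \<Rightarrow> bool" where
  "in_range x (St r i W h C k y) \<longleftrightarrow> i \<le> length x + 1 \<and> h < length W \<and> k \<le> length C - 1"

lemma mv_le: "h \<le> hi \<Longrightarrow> mv d h hi \<le> hi"
  by (cases d) auto

lemma in_range_small: "in_range x S \<Longrightarrow> in_range x (snd (small x (K, S)))"
  by (cases S) (auto split: prod.splits intro!: mv_le le_less_trans[OF mv_le])

lemma list_update_rd [simp]: "t[h := rd t h] = t"
  by (cases "h < length t") (simp_all add: rd_def list_update_beyond)

lemma small_Prim: "small x (Prim f # K, S) = (K, act x f S)"
  by (cases S) (simp split: prod.splits)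

lemma small_control:
  assumes "in_range x S"
  shows "small x ((p ;; q) # K, S) = (p # q # K, S)"
    and "small x (While b p # K, S) = (if test x b S then p # While b p # K else K, S)"
    and "small x (Cond b p q # K, S) = (if test x b S then p # K else q # K, S)"
  using assms by (cases S; auto)+

lemma exec_small:
  "exec x p S S' \<Longrightarrow> in_range x S \<Longrightarrow>
     in_range x S' \<and> (\<exists>t. (small x ^^ t) (p # K, S) = (K, S'))"
proof (induction arbitrary: K rule: exec.induct)
  case (exec_Prim f S S')
  have 1: "small x (Prim f # K, S) = (K, S')"
    using exec_Prim by (simp add: small_Prim)
  show ?case
    using in_range_small[OF exec_Prim(2), of "Prim f # K"] 1
    by (auto intro!: exI[of _ "Suc 0"])
next
  case (exec_Seq p S S' q S'')
  obtain t1 where t1: "(small x ^^ t1) (p # q # K, S) = (q # K, S')" and i: "in_range x S'"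
    using exec_Seq by blast
  obtain t2 where t2: "(small x ^^ t2) (q # K, S') = (K, S'')" and i2: "in_range x S''"
    using exec_Seq i by blast
  have "(small x ^^ (t2 + (t1 + 1))) ((p ;; q) # K, S) = (K, S'')"
    using t1 t2 by (simp only: funpow_add comp_def) (simp add: small_control[OF exec_Seq(5)])
  then show ?case using i2 by blast
next
  case (exec_WhileF b S p)
  then show ?case by (auto intro!: exI[of _ "Suc 0"] simp: small_control)
next
  case (exec_WhileT b S p S' S'')
  obtain t1 where t1: "(small x ^^ t1) (p # While b p # K, S) = (While b p # K, S')" and i: "in_range x S'"
    using exec_WhileT by blast
  obtain t2 where t2: "(small x ^^ t2) (While b p # K, S') = (K, S'')" and i2: "in_range x S''"
    using exec_WhileT i by blast
  have "(small x ^^ (t2 + (t1 + 1))) (While b p # K, S) = (K, S'')"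
    using t1 t2 exec_WhileT(1) by (simp only: funpow_add comp_def) (simp add: small_control[OF exec_WhileT(6)])
  then show ?case using i2 by blast
next
  case (exec_IfT b S p S' q)
  obtain t1 where t1: "(small x ^^ t1) (p # K, S) = (K, S')" and i: "in_range x S'"
    using exec_IfT by blast
  have "(small x ^^ (t1 + 1)) (Cond b p q # K, S) = (K, S')"
    using t1 exec_IfT(1) by (simp only: funpow_add comp_def) (simp add: small_control[OF exec_IfT(4)])
  then show ?case using i by blast
next
  case (exec_IfF b S q S' p)
  obtain t1 where t1: "(small x ^^ t1) (q # K, S) = (K, S')" and i: "in_range x S'"
    using exec_IfF by blast
  have "(small x ^^ (t1 + 1)) (Cond b p q # K, S) = (K, S')"
    using t1 exec_IfF(1) by (simp only: funpow_add comp_def) (simp add: small_control[OF exec_IfF(4)])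
  then show ?case using i by blast
qed

section \<open>Finitely many reachable stacks\<close>

fun stacks :: "'r prog \<Rightarrow> 'r prog list \<Rightarrow> 'r prog list set" where
  "stacks (Prim f) K = {Prim f # K}"
| "stacks (p ;; q) K = {(p ;; q) # K} \<union> stacks p (q # K) \<union> stacks q K"
| "stacks (While b p) K = {While b p # K} \<union> stacks p (While b p # K)"
| "stacks (Cond b p q) K = {Cond b p q # K} \<union> stacks p K \<union> stacks q K"

lemma finite_stacks [simp]: "finite (stacks p K)"
  by (induction p arbitrary: K) auto

lemma stacks_start: "p # K \<in> stacks p K"
  by (cases p) auto

fun prims_in :: "'r set \<Rightarrow> 'r prog \<Rightarrow> bool" where
  "prims_in R (Prim f) \<longleftrightarrow> (\<forall>r\<in>R. \<forall>i w b. fst (f r i w b) \<in> R)"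
| "prims_in R (p ;; q) \<longleftrightarrow> prims_in R p \<and> prims_in R q"
| "prims_in R (While b p) \<longleftrightarrow> prims_in R p"
| "prims_in R (Cond b p q) \<longleftrightarrow> prims_in R p \<and> prims_in R q"

lemma delta_closed:
  assumes "stk \<in> stacks p K" "prims_in R p" "r \<in> R"
  shows "fst (fst (delta stk r i w b)) \<in> insert K (stacks p K) \<and> snd (fst (delta stk r i w b)) \<in> R"
  using assms
proof (induction p arbitrary: K)
  case (Prim f)
  then show ?case by (auto split: prod.splits) (metis fst_conv)
next
  case (Seq p q)
  consider "stk = (p ;; q) # K" | "stk \<in> stacks p (q # K)" | "stk \<in> stacks q K"
    using Seq.prems(1) by auto
  then show ?case
    using Seq.IH(1)[of "q # K"] Seq.IH(2)[of K] Seq.prems stacks_start[of p "q # K"] stacks_start[of q K]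
    by cases auto
next
  case (While t p)
  consider "stk = While t p # K" | "stk \<in> stacks p (While t p # K)"
    using While.prems(1) by auto
  then show ?case
    using While.IH[of "While t p # K"] While.prems stacks_start[of p "While t p # K"]
    by cases auto
next
  case (Cond t p q)
  consider "stk = Cond t p q # K" | "stk \<in> stacks p K" | "stk \<in> stacks q K"
    using Cond.prems(1) by auto
  then show ?case
    using Cond.IH(1)[of K] Cond.IH(2)[of K] Cond.prems stacks_start[of p K] stacks_start[of q K]
    by cases auto
qed

section \<open>From programs to machines\<close>

text \<open>A control state of the machine consists of a program stack, the registers, the bits of the current
  row read so far, and the pending writes and moves of the work head.\<close>

type_synonym script = "(bool option \<times> dir) list"
type_synonym 'r cstate = "'r prog list \<times> 'r \<times> bool list \<times> script"

definition write_script :: "row \<Rightarrow> script" where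
  "write_script w = map (\<lambda>j. (Some (enc_row w ! j), if j = 0 then Stay else Lft)) (rev [0..<ntracks])"

fun move_script :: "dir \<Rightarrow> script" where
  "move_script Stay = []"
| "move_script Lft = replicate ntracks (None, Lft)"
| "move_script Rgt = replicate (2 * ntracks - 1) (None, Rgt) @ replicate (ntracks - 1) (None, Lft)"

fun cdelta :: "'r cstate \<Rightarrow> bool option \<Rightarrow> bool \<Rightarrow> bool \<Rightarrow>
    'r cstate \<times> bool \<times> bool \<times> dir \<times> dir \<times> dir \<times> out option" where
  "cdelta (K, r, buf, (v, d) # scr) i a b =
     ((K, r, buf, scr), (case v of None \<Rightarrow> a | Some v' \<Rightarrow> v'), b, Stay, d, Stay, None)"
| "cdelta (K, r, buf, []) i a b =
     (if length buf < ntracks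
      then ((K, r, buf @ [a], []), a, b, Stay, if Suc (length buf) < ntracks then Rgt else Stay, Stay, None)
      else (case delta K r i (dec_row buf) b of ((K', r'), w, b', di, dw, dc, oo) \<Rightarrow>
        ((K', r', [], write_script w @ move_script dw), a, b', di, Stay, dc, oo)))"

fun chalt :: "'r cstate \<Rightarrow> bool" where
  "chalt (K, r, buf, scr) \<longleftrightarrow> K = [] \<and> buf = [] \<and> scr = []"

fun cstep :: "bool list \<Rightarrow> 'r cstate \<times> conf \<Rightarrow> 'r cstate \<times> conf" where
  "cstep x (q, C) = (if chalt q then (q, C) else
     (case cdelta q (inp x (ih C)) (rd (wt C) (wh C)) (rd (ct C) (ch C)) of
       (q', wb, cb, di, dw, dc, oo) \<Rightarrow>
         (q', C\<lparr> ih := mv di (ih C) (length x + 1),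
            wt := (wt C)[wh C := wb],
            wh := mv dw (wh C) (length (wt C) - 1),
            ct := (ct C)[ch C := cb],
            ch := mv dc (ch C) (length (ct C) - 1),
            ot := ot C @ (case oo of None \<Rightarrow> [] | Some sy \<Rightarrow> [sy]) \<rparr>)))"

definition flat :: "row list \<Rightarrow> bool list" where
  "flat W = map (\<lambda>i. enc_row (W ! (i div ntracks)) ! (i mod ntracks)) [0..<ntracks * length W]"

lemma length_flat [simp]: "length (flat W) = ntracks * length W"
  by (simp add: flat_def)

lemma flat_index_less: "h < length W \<Longrightarrow> j < ntracks \<Longrightarrow> ntracks * h + j < ntracks * length W"
proof -
  assume a: "h < length W" "j < ntracks"
  have "ntracks * h + j < ntracks * Suc h" using a by simp
  also have "\<dots> \<le> ntracks * length W" using a by (intro mult_le_mono2) simp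
  finally show ?thesis .
qed

lemma rd_flat: "h < length W \<Longrightarrow> j < ntracks \<Longrightarrow> rd (flat W) (ntracks * h + j) = enc_row (W ! h) ! j"
  using flat_index_less[of h W j] by (simp add: rd_def flat_def)

lemma flat_replicate_blank: "flat (replicate n blank_row) = replicate (ntracks * n) False"
  by (rule nth_equalityI) (auto simp: flat_def enc_blank_row less_mult_imp_div_less mult.commute)

fun run_script :: "script \<Rightarrow> bool list \<Rightarrow> nat \<Rightarrow> bool list \<times> nat" where
  "run_script [] t h = (t, h)"
| "run_script ((v, d) # s) t h =
     run_script s (t[h := (case v of None \<Rightarrow> rd t h | Some v' \<Rightarrow> v')]) (mv d h (length t - 1))"

lemma run_script_append:
  "run_script (s @ s') t h = (case run_script s t h of (t', h') \<Rightarrow> run_script s' t' h')"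
  by (induction s t h rule: run_script.induct) auto

lemma run_script_moves:
  "run_script (replicate n (None, d)) t h = (t, ((\<lambda>h. mv d h (length t - 1)) ^^ n) h)"
proof (induction n arbitrary: h)
  case (Suc n)
  then show ?case by (simp add: funpow_Suc_right del: mv.simps funpow.simps)
qed simp

lemma funpow_mv_Lft: "((\<lambda>h. mv Lft h hi) ^^ n) h = h - n"
  by (induction n) auto

lemma funpow_mv_Rgt: "h \<le> hi \<Longrightarrow> ((\<lambda>h. mv Rgt h hi) ^^ n) h = min (h + n) hi"
  by (induction n) auto

lemma funpow_mv_Stay: "h \<le> hi \<Longrightarrow> ((\<lambda>h. mv Stay h hi) ^^ n) h = h"
  by (induction n) auto

lemma run_move_script:
  assumes "h < length W"
  shows "run_script (move_script d) (flat W) (ntracks * h) = (flat W, ntracks * mv d h (length W - 1))"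
proof (cases d)
  case Lft
  then show ?thesis by (simp add: run_script_moves funpow_mv_Lft del: mv.simps(1)) (simp add: diff_mult_distrib2)
next
  case Stay
  then show ?thesis using assms by simp
next
  case Rgt
  have le: "ntracks * h \<le> ntracks * length W - 1"
    using flat_index_less[OF assms ntracks_pos] by linarith
  have 1: "run_script (move_script d) (flat W) (ntracks * h) =
     (flat W, min (ntracks * h + (2 * ntracks - 1)) (ntracks * length W - 1) - (ntracks - 1))"
    using le unfolding Rgt
    by (simp add: run_script_append run_script_moves funpow_mv_Lft funpow_mv_Rgt del: mv.simps)
  have "min (ntracks * h + (2 * ntracks - 1)) (ntracks * length W - 1) - (ntracks - 1) = ntracks * min (Suc h) (length W - 1)"
  proof (cases "Suc h < length W")
    case True
    then obtain e where "length W = Suc (Suc h) + e" by (metis less_iff_Suc_add add_Suc)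
    then show ?thesis by (simp add: min_def ntracks_def)
  next
    case False
    then have "length W = Suc h" using assms by simp
    then show ?thesis by (simp add: min_def ntracks_def)
  qed
  with 1 show ?thesis by (simp add: Rgt)
qed

lemma run_write_prefix:
  assumes "n < ntracks" "h + n < length t"
  shows "run_script (map (\<lambda>j. (Some (e ! j), if j = 0 then Stay else Lft)) (rev [0..<Suc n])) t (h + n) =
     (map (\<lambda>i. if h \<le> i \<and> i \<le> h + n then e ! (i - h) else t ! i) [0..<length t], h)"
  using assms
proof (induction n arbitrary: t)
  case 0
  then show ?case by (auto intro!: nth_equalityI simp: nth_list_update)
next
  case (Suc n)
  show ?case
    unfolding upt_Suc[of 0 "Suc n"] using Suc.prems
    by (simp del: upt_Suc, subst Suc.IH) (auto intro!: nth_equalityI simp: nth_list_update simp del: upt_Suc)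
qed

lemma flat_update:
  assumes "h < length W"
  shows "map (\<lambda>i. if ntracks * h \<le> i \<and> i \<le> ntracks * h + (ntracks - 1)
      then enc_row w ! (i - ntracks * h) else flat W ! i) [0..<ntracks * length W] = flat (W[h := w])"
proof (rule nth_equalityI)
  fix i assume "i < length (map (\<lambda>i. if ntracks * h \<le> i \<and> i \<le> ntracks * h + (ntracks - 1)
      then enc_row w ! (i - ntracks * h) else flat W ! i) [0..<ntracks * length W])"
  then have i: "i < ntracks * length W" by simp
  have eq: "ntracks * h \<le> i \<and> i \<le> ntracks * h + (ntracks - 1) \<longleftrightarrow> i div ntracks = h"
    by (auto simp: ntracks_def)
  have sub: "i div ntracks = h \<Longrightarrow> i - ntracks * h = i mod ntracks"
    by (metis minus_mult_div_eq_mod)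
  show "map (\<lambda>i. if ntracks * h \<le> i \<and> i \<le> ntracks * h + (ntracks - 1)
      then enc_row w ! (i - ntracks * h) else flat W ! i) [0..<ntracks * length W] ! i = flat (W[h := w]) ! i"
    using i assms eq sub by (simp add: flat_def nth_list_update)
qed simp_all

lemma run_write_script:
  assumes "h < length W"
  shows "run_script (write_script w) (flat W) (ntracks * h + (ntracks - 1)) = (flat (W[h := w]), ntracks * h)"
  using run_write_prefix[of "ntracks - 1" "ntracks * h" "flat W" "enc_row w"]
    flat_index_less[OF assms, of "ntracks - 1"] flat_update[OF assms, of w]
  by (simp add: write_script_def del: upt_Suc)

lemma cstep_script:
  assumes "ih C \<le> length x + 1" "ch C \<le> length (ct C) - 1"
  shows "(cstep x ^^ length s) ((K, r, buf, s @ s'), C) =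
    ((K, r, buf, s'), C\<lparr>wt := fst (run_script s (wt C) (wh C)), wh := snd (run_script s (wt C) (wh C))\<rparr>)"
  using assms
proof (induction s arbitrary: C)
  case Nil
  then show ?case by simp
next
  case (Cons a s)
  obtain v d where a: "a = (v, d)" by (cases a)
  have 1: "cstep x ((K, r, buf, (a # s) @ s'), C) = ((K, r, buf, s @ s'),
     C\<lparr>wt := (wt C)[wh C := (case v of None \<Rightarrow> rd (wt C) (wh C) | Some v' \<Rightarrow> v')],
       wh := mv d (wh C) (length (wt C) - 1)\<rparr>)"
    using Cons.prems by (simp add: a)
  show ?case
    using Cons.prems by (simp only: length_Cons funpow_Suc_right comp_def 1) (subst Cons.IH, auto simp: a)
qed

fun repr :: "'r prog list \<times> 'r state \<Rightarrow> 'r cstate \<times> conf" where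
  "repr (K, St r i W h C k y) =
     ((K, r, [], []), \<lparr>st = 0, ih = i, wt = flat W, wh = ntracks * h, ct = C, ch = k, ot = y\<rparr>)"

lemma cstep_read:
  assumes "K \<noteq> []" "i \<le> length x + 1" "h < length W" "k \<le> length C - 1" "j \<le> ntracks"
  shows "(cstep x ^^ j) (repr (K, St r i W h C k y)) =
     ((K, r, take j (enc_row (W ! h)), []),
      \<lparr>st = 0, ih = i, wt = flat W, wh = ntracks * h + min j (ntracks - 1), ct = C, ch = k, ot = y\<rparr>)"
  using assms(5)
proof (induction j)
  case 0
  then show ?case by simp
next
  case (Suc j)
  then have j: "j < ntracks" by simp
  then have m: "min j (ntracks - 1) = j" by simp
  have l: "ntracks * h + j < ntracks * length W" "Suc j < ntracks \<Longrightarrow> ntracks * h + Suc j < ntracks * length W"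
    using flat_index_less[OF assms(3), of j] flat_index_less[OF assms(3), of "Suc j"] j by simp_all
  have t: "take (Suc j) (enc_row (W ! h)) = take j (enc_row (W ! h)) @ [enc_row (W ! h) ! j]"
    using j by (simp add: take_Suc_conv_app_nth)
  have u: "(flat W)[ntracks * h + j := enc_row (W ! h) ! j] = flat W"
    unfolding rd_flat[OF assms(3) j, symmetric] by (rule list_update_rd)
  show ?case
    using Suc assms(1-4) j l by (auto simp: m rd_flat t u)
qed

lemma cstep_small:
  assumes "K \<noteq> []" "in_range x S"
  shows "\<exists>t. (cstep x ^^ t) (repr (K, S)) = repr (small x (K, S))"
proof -
  obtain r i W h C k y where S: "S = St r i W h C k y" by (cases S)
  have rng: "i \<le> length x + 1" "h < length W" "k \<le> length C - 1" using assms(2) S by auto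
  obtain K' r' w b di dw dc oo where d:
    "delta K r (inp x i) (W ! h) (rd C k) = ((K', r'), w, b, di, dw, dc, oo)"
    by (metis surj_pair)
  have hi: "ntracks * h + (ntracks - 1) \<le> ntracks * length W - 1"
    using flat_index_less[OF rng(2), of "ntracks - 1"] by simp
  let ?y = "y @ (case oo of None \<Rightarrow> [] | Some sy \<Rightarrow> [sy])"
  let ?C = "\<lparr>st = 0, ih = mv di i (length x + 1), wt = flat W, wh = ntracks * h + (ntracks - 1),
     ct = C[k := b], ch = mv dc k (length C - 1), ot = ?y\<rparr>"
  have 1: "(cstep x ^^ Suc ntracks) (repr (K, S)) = ((K', r', [], write_script w @ move_script dw), ?C)"
    using assms(1) hi unfolding S
    by (simp only: funpow.simps comp_def cstep_read[OF assms(1) rng order_refl]) (simp add: d min.absorb1)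
  let ?s = "write_script w @ move_script dw"
  have 2: "(cstep x ^^ length ?s) ((K', r', [], ?s @ []), ?C) =
    ((K', r', [], []), ?C\<lparr>wt := fst (run_script ?s (wt ?C) (wh ?C)), wh := snd (run_script ?s (wt ?C) (wh ?C))\<rparr>)"
    using rng by (intro cstep_script) (auto intro!: mv_le simp: mv_le)
  have 3: "run_script ?s (wt ?C) (wh ?C) = (flat (W[h := w]), ntracks * mv dw h (length W - 1))"
    using run_write_script[OF rng(2)] run_move_script[of h "W[h := w]" dw] rng(2)
    by (simp add: run_script_append)
  have "(cstep x ^^ (length ?s + Suc ntracks)) (repr (K, S)) = repr (small x (K, S))"
    using 2 unfolding 3 by (simp only: funpow_add comp_def 1) (simp add: S d)
  then show ?thesis by blast
qed

lemma cstep_smalls: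
  assumes "in_range x S" "(small x ^^ t) (K, S) = ([], S')"
  shows "\<exists>t. (cstep x ^^ t) (repr (K, S)) = repr ([], S')"
  using assms
proof (induction t arbitrary: K S)
  case 0
  then show ?case by (auto intro: exI[of _ 0])
next
  case (Suc t)
  show ?case
  proof (cases "K = []")
    case True
    have "small x ([], S) = ([], S)" using Suc.prems(1) by (cases S) auto
    then have "(small x ^^ n) ([], S) = ([], S)" for n by (induction n) auto
    then show ?thesis using Suc.prems True by (auto intro: exI[of _ 0] simp del: funpow.simps)
  next
    case False
    obtain K1 S1 where 1: "small x (K, S) = (K1, S1)" by fastforce
    have "in_range x S1" using in_range_small[OF Suc.prems(1), of K] 1 by simp
    then obtain t2 where t2: "(cstep x ^^ t2) (repr (K1, S1)) = repr ([], S')"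
      using Suc.IH[of S1 K1] Suc.prems(2) 1 by (auto simp: funpow_Suc_right simp del: funpow.simps)
    obtain t1 where "(cstep x ^^ t1) (repr (K, S)) = repr (K1, S1)"
      using cstep_small[OF False Suc.prems(1)] 1 by auto
    then have "(cstep x ^^ (t2 + t1)) (repr (K, S)) = repr ([], S')"
      using t2 by (simp add: funpow_add)
    then show ?thesis by blast
  qed
qed

definition cstates :: "'r set \<Rightarrow> 'r prog \<Rightarrow> 'r cstate set" where
  "cstates R p = insert [] (stacks p []) \<times> R \<times> {buf. length buf \<le> ntracks} \<times> {s. length s \<le> 5 * ntracks}"

lemma UNIV_dir: "(UNIV :: dir set) = {Lft, Stay, Rgt}"
  using dir.exhaust by auto

lemma finite_dir [simp]: "finite (UNIV :: dir set)"
  by (simp add: UNIV_dir)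

lemma finite_cstates: "finite R \<Longrightarrow> finite (cstates R p)"
proof -
  assume R: "finite R"
  have f: "finite (UNIV :: (bool option \<times> dir) set)"
    by (simp flip: UNIV_Times_UNIV)
  have "finite {buf :: bool list. length buf \<le> ntracks}"
    using finite_lists_length_le[of "UNIV :: bool set" ntracks] by simp
  moreover have "finite {s :: script. length s \<le> 5 * ntracks}"
    using finite_lists_length_le[OF f, of "5 * ntracks"] by simp
  ultimately show ?thesis using R by (simp add: cstates_def)
qed

lemma length_scripts: "length (write_script w @ move_script d) \<le> 5 * ntracks"
  by (cases d) (simp_all add: write_script_def ntracks_def)

lemma cdelta_closed:
  assumes "q \<in> cstates R p" "prims_in R p"
  shows "fst (cdelta q i a b) \<in> cstates R p"
proof -
  obtain K r buf s where q: "q = (K, r, buf, s)" by (cases q)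
  have in': "K \<in> insert [] (stacks p [])" "r \<in> R" "length buf \<le> ntracks" "length s \<le> 5 * ntracks"
    using assms(1) by (auto simp: q cstates_def)
  show ?thesis
  proof (cases s)
    case (Cons m s')
    then show ?thesis using in' by (cases m) (auto simp: q cstates_def)
  next
    case Nil
    show ?thesis
    proof (cases "length buf < ntracks")
      case True
      then show ?thesis using in' by (auto simp: q Nil cstates_def)
    next
      case False
      let ?d = "delta K r i (dec_row buf) b"
      have "fst (fst ?d) \<in> insert [] (stacks p []) \<and> snd (fst ?d) \<in> R"
        using in' delta_closed[OF _ assms(2), of K "[]" r] by (cases "K = []") auto
      then show ?thesis
        using False length_scripts by (auto simp: q Nil cstates_def split: prod.splits)
    qed
  qed
qed

lemma obtain_numbering:
  assumes "finite Q" "q0 \<in> Q"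
  obtains e :: "'q \<Rightarrow> nat" and n where "inj_on e Q" "e q0 = 0" "e ` Q \<subseteq> {..<n}" "0 < n"
proof -
  obtain f :: "'q \<Rightarrow> nat" and m where f: "f ` Q = {i. i < m}" "inj_on f Q"
    using finite_imp_inj_to_nat_seg[OF assms(1)] by blast
  define g where "g i = (if i = f q0 then 0 else Suc i)" for i
  have "inj g" by (auto simp: inj_def g_def)
  then have "inj_on (g \<circ> f) Q" using f(2) by (meson comp_inj_on inj_on_subset subset_UNIV)
  moreover have "(g \<circ> f) ` Q \<subseteq> {..<Suc m}" using f(1) by (auto simp: g_def)
  ultimately show thesis using that[of "g \<circ> f" "Suc m"] by (simp add: g_def)
qed

theorem program_to_machine:
  fixes p :: "'r prog"
  assumes R: "finite R" "r0 \<in> R" and p: "prims_in R p"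
  obtains M where "wf_mach M"
    and "\<And>x n \<tau> r i W h C k y. 0 < n \<Longrightarrow>
      exec x p (St r0 0 (replicate n blank_row) 0 \<tau> 0 []) (St r i W h C k y) \<Longrightarrow>
      halts M x (ntracks * n) \<tau> \<and> ct (final M x (ntracks * n) \<tau>) = C \<and> ot (final M x (ntracks * n) \<tau>) = y"
proof -
  let ?Q = "cstates R p" and ?q0 = "([p], r0, [], []) :: 'r cstate"
  have q0: "?q0 \<in> ?Q" using R stacks_start[of p "[]"] by (simp add: cstates_def)
  obtain e :: "'r cstate \<Rightarrow> nat" and n where e: "inj_on e ?Q" "e ?q0 = 0" "e ` ?Q \<subseteq> {..<n}" "0 < n"
    by (rule obtain_numbering[OF finite_cstates[OF R(1)] q0])
  define D where "D = inv_into ?Q e"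
  have De: "D (e q) = q" if "q \<in> ?Q" for q using that e(1) by (simp add: D_def)
  define M where "M = \<lparr>nst = n, hlt = (\<lambda>i. chalt (D i)),
     dlt = (\<lambda>i a b c. if i \<in> e ` ?Q then (case cdelta (D i) a b c of (q, rest) \<Rightarrow> (e q, rest))
       else (0, b, c, Stay, Stay, Stay, None))\<rparr>"
  have wf: "wf_mach M"
    unfolding wf_mach_def
  proof (intro conjI allI impI)
    show "0 < nst M" using e(4) by (simp add: M_def)
    fix i a b c
    show "fst (dlt M i a b c) < nst M"
    proof (cases "i \<in> e ` ?Q")
      case True
      then obtain q where q: "q \<in> ?Q" "i = e q" by auto
      obtain q' z where d: "cdelta q a b c = (q', z)" by (metis surj_pair)
      have "q' \<in> ?Q" using cdelta_closed[OF q(1) p, of a b c] d by simp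
      then have "e q' < n" using e(3) by blast
      then show ?thesis using True d De[OF q(1)] by (simp add: M_def q(2))
    qed (use e(4) in \<open>simp add: M_def\<close>)
  qed
  have step: "step M x (C\<lparr>st := e q\<rparr>) = (snd (cstep x (q, C)))\<lparr>st := e (fst (cstep x (q, C)))\<rparr>
      \<and> fst (cstep x (q, C)) \<in> ?Q" if "q \<in> ?Q" for x q C
  proof (cases "chalt q")
    case True
    then show ?thesis using that by (simp add: step_def M_def De)
  next
    case False
    obtain q' wb cb di dw dc oo where d:
      "cdelta q (inp x (ih C)) (rd (wt C) (wh C)) (rd (ct C) (ch C)) = (q', wb, cb, di, dw, dc, oo)"
      by (metis surj_pair)
    have "q' \<in> ?Q"
      using cdelta_closed[OF that p, of "inp x (ih C)" "rd (wt C) (wh C)" "rd (ct C) (ch C)"] d by simp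
    then show ?thesis
      using False that d by (simp add: step_def M_def De)
  qed
  have steps: "(step M x ^^ t) (C\<lparr>st := e q\<rparr>) = (snd ((cstep x ^^ t) (q, C)))\<lparr>st := e (fst ((cstep x ^^ t) (q, C)))\<rparr>
      \<and> fst ((cstep x ^^ t) (q, C)) \<in> ?Q" if "q \<in> ?Q" for x q C t
  proof (induction t)
    case 0
    then show ?case using that by simp
  next
    case (Suc t)
    then show ?case using step[of "fst ((cstep x ^^ t) (q, C))" x "snd ((cstep x ^^ t) (q, C))"] by simp
  qed
  have res: "halts M x (ntracks * m) \<tau> \<and> ct (final M x (ntracks * m) \<tau>) = C \<and> ot (final M x (ntracks * m) \<tau>) = y"
    if m: "0 < m" and ex: "exec x p (St r0 0 (replicate m blank_row) 0 \<tau> 0 []) (St r i W h C k y)"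
    for x m \<tau> r i W h C k y
  proof -
    let ?S = "St r0 0 (replicate m blank_row) 0 \<tau> 0 []" and ?S' = "St r i W h C k y"
    let ?I = "init x (ntracks * m) \<tau>"
    have rng: "in_range x ?S" using m by simp
    obtain t where "(small x ^^ t) ([p], ?S) = ([], ?S')"
      using exec_small[OF ex rng] by blast
    then obtain t where t: "(cstep x ^^ t) (repr ([p], ?S)) = repr ([], ?S')"
      using cstep_smalls[OF rng] by blast
    have I: "snd (repr ([p], ?S))\<lparr>st := e ?q0\<rparr> = ?I"
      by (simp add: init_def flat_replicate_blank e)
    have run: "(step M x ^^ t) ?I = (snd (repr ([], ?S')))\<lparr>st := e (fst (repr ([], ?S')))\<rparr>
       \<and> fst (repr ([], ?S')) \<in> ?Q"
      using steps[OF q0, of t x "snd (repr ([p], ?S))"] t unfolding I by simp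
    have hl: "hlt M (st ((step M x ^^ t) ?I))"
      using run by (simp add: M_def De)
    have stay: "hlt M (st Y) \<Longrightarrow> (step M x ^^ d) Y = Y" for d Y
      by (induction d) (auto simp: step_def)
    define l where "l = (LEAST t. hlt M (st ((step M x ^^ t) ?I)))"
    have l: "hlt M (st ((step M x ^^ l) ?I))" "l \<le> t"
      using hl unfolding l_def by (auto intro: LeastI Least_le)
    have "(step M x ^^ t) ?I = (step M x ^^ (t - l)) ((step M x ^^ l) ?I)"
      using l(2) by (metis add.commute comp_apply funpow_add le_add_diff_inverse)
    then have "final M x (ntracks * m) \<tau> = (step M x ^^ t) ?I"
      using stay[OF l(1)] by (simp add: final_def l_def)
    moreover have "halts M x (ntracks * m) \<tau>"
      unfolding halts_def using hl by blast
    ultimately show ?thesis using run by simp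
  qed
  show thesis by (rule that[OF wf res])
qed

lemma exec_Prim_Seq: "exec x q (act x f S) S' \<Longrightarrow> exec x (Prim f ;; q) S S'"
  by (rule exec_Seq[OF exec_Prim[OF refl]])

inductive_cases exec_SeqE: "exec x (p ;; q) S S'"

definition move :: "dir \<Rightarrow> dir \<Rightarrow> dir \<Rightarrow> 'r prog" where
  "move di dw dc = Prim (\<lambda>r i w b. (r, w, b, di, dw, dc, None))"

definition edit_row :: "(row \<Rightarrow> row) \<Rightarrow> dir \<Rightarrow> 'r prog" where
  "edit_row f d = Prim (\<lambda>r i w b. (r, f w, b, Stay, d, Stay, None))"

definition scan :: "(row \<Rightarrow> bool) \<Rightarrow> dir \<Rightarrow> 'r prog" where
  "scan P d = While (\<lambda>r i w b. P w) (move Stay Rgt d)"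

definition rewind :: "'r prog" where
  "rewind = While (\<lambda>r i w b. \<not> tO w) (move Stay Lft Stay)"

lemma exec_move:
  "exec x (move di dw dc) (St r i W h C k y)
     (St r (mv di i (length x + 1)) W (mv dw h (length W - 1)) C (mv dc k (length C - 1)) y)"
  unfolding move_def by (rule exec_Prim) simp

lemma exec_edit_row:
  assumes "i \<le> length x + 1" "k \<le> length C - 1"
  shows "exec x (edit_row f d) (St r i W h C k y)
     (St r i (W[h := f (W ! h)]) (mv d h (length W - 1)) C k y)"
  unfolding edit_row_def using assms by (intro exec_Prim) (simp add: min_def)

lemma exec_scan:
  assumes "i \<le> length x + 1" "k \<le> length C - 1"
    and "\<And>t. a \<le> t \<Longrightarrow> t < e \<Longrightarrow> P (W ! t)" "\<not> P (W ! e)" "a \<le> e" "e < length W"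
  shows "exec x (scan P d) (St r i W a C k y)
     (St r i W e C (((\<lambda>k. mv d k (length C - 1)) ^^ (e - a)) k) y)"
  using assms
proof (induction "e - a" arbitrary: a k)
  case 0
  then show ?case by (auto simp: scan_def intro: exec_WhileF)
next
  case (Suc n)
  have e: "e - a = Suc (e - Suc a)" and lt: "a < e" using Suc.hyps(2) by auto
  have 1: "exec x (move Stay Rgt d) (St r i W a C k y)
     (St r i W (Suc a) C (mv d k (length C - 1)) y)"
    using exec_move[of x Stay Rgt d r i W a C k y] Suc.prems lt
    by (simp add: min.absorb1 min.absorb2)
  have 2: "exec x (scan P d) (St r i W (Suc a) C (mv d k (length C - 1)) y)
     (St r i W e C (((\<lambda>k. mv d k (length C - 1)) ^^ (e - Suc a)) (mv d k (length C - 1))) y)"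
    using Suc.prems lt Suc.hyps(2) by (intro Suc.hyps(1)) (auto intro: mv_le)
  have t: "test x (\<lambda>r i w b. P w) (St r i W a C k y)" using Suc.prems(3)[of a] lt by simp
  show ?case
    unfolding e funpow_Suc_right comp_def
    using exec_WhileT[OF t 1] 2 unfolding scan_def by blast
qed

lemma exec_rewind:
  assumes "i \<le> length x + 1" "k \<le> length C - 1" "h < length W"
    and "tO (W ! 0)" "\<And>t. 0 < t \<Longrightarrow> t < length W \<Longrightarrow> \<not> tO (W ! t)"
  shows "exec x rewind (St r i W h C k y) (St r i W 0 C k y)"
  using assms(3)
proof (induction h)
  case 0
  then show ?case using assms unfolding rewind_def by (intro exec_WhileF) simp
next
  case (Suc h)
  have 1: "exec x (move Stay Lft Stay) (St r i W (Suc h) C k y) (St r i W h C k y)"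
    using exec_move[of x Stay Lft Stay r i W "Suc h" C k y] assms by (simp add: min_def)
  have t: "test x (\<lambda>r i w b. \<not> tO w) (St r i W (Suc h) C k y)" using assms(5)[of "Suc h"] Suc.prems by simp
  show ?case
    using exec_WhileT[OF t 1] Suc unfolding rewind_def by simp
qed

section \<open>Rows given by their tracks\<close>

definition mk :: "nat \<Rightarrow> (nat \<Rightarrow> bool) \<Rightarrow> (nat \<Rightarrow> bool) \<Rightarrow> (nat \<Rightarrow> bool) \<Rightarrow> (nat \<Rightarrow> bool) \<Rightarrow> (nat \<Rightarrow> bool) \<Rightarrow>
    (nat \<Rightarrow> bool) \<Rightarrow> (nat \<Rightarrow> bool) \<Rightarrow> row list" where
  "mk n a og e u b j h =
     map (\<lambda>i. \<lparr>tA = a i, tO = og i, tE = e i, tU = u i, tB = b i, tJ = j i, tH = h i\<rparr>) [0..<n]"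

lemma length_mk [simp]: "length (mk n a og e u b j h) = n"
  by (simp add: mk_def)

lemma nth_mk [simp]: "t < n \<Longrightarrow> mk n a og e u b j h ! t =
    \<lparr>tA = a t, tO = og t, tE = e t, tU = u t, tB = b t, tJ = j t, tH = h t\<rparr>"
  by (simp add: mk_def)

lemma mk_update [simp]:
  "(mk n a og e u b j h)[t := \<lparr>tA = a', tO = o', tE = e', tU = u', tB = b', tJ = j', tH = h'\<rparr>] =
    mk n (a(t := a')) (og(t := o')) (e(t := e')) (u(t := u')) (b(t := b')) (j(t := j')) (h(t := h'))"
  by (rule nth_equalityI) (auto simp: nth_list_update)

lemma mk_cong:
  assumes "\<And>i. i < n \<Longrightarrow> a i = a' i \<and> og i = og' i \<and> e i = e' i \<and> u i = u' i \<and> b i = b' i \<and> j i = j' i \<and> h i = h' i"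
  shows "mk n a og e u b j h = mk n a' og' e' u' b' j' h'"
  using assms by (intro nth_equalityI) auto

definition only :: "nat \<Rightarrow> nat \<Rightarrow> bool" where
  "only j i \<longleftrightarrow> i = j"

definition below :: "nat \<Rightarrow> nat \<Rightarrow> bool" where
  "below m i \<longleftrightarrow> i < m"

definition never :: "nat \<Rightarrow> bool" where
  "never i \<longleftrightarrow> False"

lemma exec_rewind_mk:
  assumes "i \<le> length x + 1" "k \<le> length C - 1" "h < n"
  shows "exec x rewind (St r i (mk n a (only 0) e u b j hm) h C k y) (St r i (mk n a (only 0) e u b j hm) 0 C k y)"
  using assms by (intro exec_rewind) (auto simp: only_def)

lemma blank_rows: "replicate n blank_row = mk n never never never never never never never"
  by (rule nth_equalityI) (auto simp: never_def blank_row_def)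

definition init_rows :: "'r prog" where
  "init_rows = edit_row (\<lambda>w. w\<lparr>tO := True\<rparr>) Stay ;;
     While (\<lambda>r i w b. \<not> tA w) (edit_row (\<lambda>w. w\<lparr>tA := True\<rparr>) Rgt) ;;
     edit_row (\<lambda>w. w\<lparr>tE := True\<rparr>) Stay ;; rewind"

lemma exec_fill_A:
  assumes "i \<le> length x + 1" "k \<le> length C - 1" "t < n"
  shows "exec x (While (\<lambda>r i w b. \<not> tA w) (edit_row (\<lambda>w. w\<lparr>tA := True\<rparr>) Rgt))
     (St r i (mk n (below t) og e u b j hm) t C k y) (St r i (mk n (below n) og e u b j hm) (n - 1) C k y)"
  using assms(3)
proof (induction "n - t" arbitrary: t)
  case 0
  then show ?case by simp
next
  case (Suc m)
  let ?b = "\<lambda>r i w (b :: bool). \<not> tA w"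
  have up: "(below t)(t := True) = below (Suc t)" by (auto simp: below_def fun_eq_iff)
  have 1: "exec x (edit_row (\<lambda>w. w\<lparr>tA := True\<rparr>) Rgt) (St r i (mk n (below t) og e u b j hm) t C k y)
     (St r i (mk n (below (Suc t)) og e u b j hm) (min (Suc t) (n - 1)) C k y)"
    using exec_edit_row[OF assms(1,2), of "\<lambda>w. w\<lparr>tA := True\<rparr>" Rgt r "mk n (below t) og e u b j hm" t y] Suc.prems
    by (simp add: up)
  have t: "test x ?b (St r i (mk n (below t) og e u b j hm) t C k y)"
    using Suc.prems by (simp add: below_def)
  show ?case
  proof (cases "Suc t < n")
    case True
    have "min (Suc t) (n - 1) = Suc t" using True by simp
    then show ?thesis using exec_WhileT[OF t 1] Suc.hyps(1)[of "Suc t"] True Suc.hyps(2) by simp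
  next
    case False
    then have n: "n = Suc t" using Suc.prems by simp
    have "\<not> test x ?b (St r i (mk n (below (Suc t)) og e u b j hm) t C k y)"
      using n by (simp add: below_def)
    from exec_WhileF[OF this] show ?thesis using exec_WhileT[OF t 1] n by simp
  qed
qed

lemma exec_init_rows:
  assumes "i \<le> length x + 1" "k \<le> length C - 1" "0 < n"
  shows "exec x init_rows (St r i (replicate n blank_row) 0 C k y)
    (St r i (mk n (below n) (only 0) (only (n - 1)) never never never never) 0 C k y)"
proof -
  have 0: "never(t := True) = only t" for t by (auto simp: never_def only_def fun_eq_iff)
  have 1: "exec x (edit_row (\<lambda>w. w\<lparr>tO := True\<rparr>) Stay) (St r i (mk n never never never never never never never) 0 C k y)
    (St r i (mk n never (only 0) never never never never never) 0 C k y)"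
    using exec_edit_row[OF assms(1,2), of "\<lambda>w. w\<lparr>tO := True\<rparr>" Stay r "mk n never never never never never never never" 0 y] assms(3)
    by (simp add: 0)
  have b: "never = below 0" by (auto simp: never_def below_def fun_eq_iff)
  have 2: "exec x (While (\<lambda>r i w b. \<not> tA w) (edit_row (\<lambda>w. w\<lparr>tA := True\<rparr>) Rgt))
     (St r i (mk n never (only 0) never never never never never) 0 C k y) (St r i (mk n (below n) (only 0) never never never never never) (n - 1) C k y)"
    using exec_fill_A[OF assms(1-3)] b by metis
  have 3: "exec x (edit_row (\<lambda>w. w\<lparr>tE := True\<rparr>) Stay) (St r i (mk n (below n) (only 0) never never never never never) (n - 1) C k y)
    (St r i (mk n (below n) (only 0) (only (n - 1)) never never never never) (n - 1) C k y)"
    using exec_edit_row[OF assms(1,2), of "\<lambda>w. w\<lparr>tE := True\<rparr>" Stay r "mk n (below n) (only 0) never never never never never" "n - 1" y] assms(3)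
    by (simp add: 0)
  show ?thesis unfolding blank_rows init_rows_def
    by (intro exec_Seq[OF 1] exec_Seq[OF 2] exec_Seq[OF 3] exec_rewind_mk assms) (use assms(3) in simp)
qed

definition clear_A :: "'r prog" where
  "clear_A = While (\<lambda>r i w b. \<not> tE w) (edit_row (\<lambda>w. w\<lparr>tA := False\<rparr>) Rgt) ;;
     edit_row (\<lambda>w. w\<lparr>tA := False\<rparr>) Stay ;; rewind"

lemma exec_clear_A:
  assumes "i \<le> length x + 1" "k \<le> length C - 1" "0 < n"
  shows "exec x clear_A (St r i (mk n a (only 0) (only (n - 1)) u b j hm) 0 C k y)
     (St r i (mk n never (only 0) (only (n - 1)) u b j hm) 0 C k y)"
proof -
  let ?c = "\<lambda>t i. \<not> i < t \<and> a i"
  have up: "(?c t)(t := False) = ?c (Suc t)" for t by (auto simp: less_Suc_eq fun_eq_iff)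
  have loop: "exec x (While (\<lambda>r i w b. \<not> tE w) (edit_row (\<lambda>w. w\<lparr>tA := False\<rparr>) Rgt))
    (St r i (mk n (?c t) (only 0) (only (n - 1)) u b j hm) t C k y)
    (St r i (mk n (?c (n - 1)) (only 0) (only (n - 1)) u b j hm) (n - 1) C k y)" if "t < n" for t
    using that
  proof (induction "n - 1 - t" arbitrary: t)
    case 0
    then have "t = n - 1" by simp
    then show ?case using 0 by (simp add: exec_WhileF only_def)
  next
    case (Suc m)
    have lt: "Suc t < n" using Suc.hyps(2) by simp
    have 1: "exec x (edit_row (\<lambda>w. w\<lparr>tA := False\<rparr>) Rgt) (St r i (mk n (?c t) (only 0) (only (n - 1)) u b j hm) t C k y)
       (St r i (mk n (?c (Suc t)) (only 0) (only (n - 1)) u b j hm) (Suc t) C k y)"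
      using exec_edit_row[OF assms(1,2), of "\<lambda>w. w\<lparr>tA := False\<rparr>" Rgt r "mk n (?c t) (only 0) (only (n - 1)) u b j hm" t y] lt
      by (simp add: up min.absorb1)
    have t: "test x (\<lambda>r i w b. \<not> tE w) (St r i (mk n (?c t) (only 0) (only (n - 1)) u b j hm) t C k y)"
      using lt by (simp add: only_def)
    show ?case using exec_WhileT[OF t 1] Suc.hyps(1)[of "Suc t"] lt Suc.hyps(2) by simp
  qed
  have 2: "exec x (edit_row (\<lambda>w. w\<lparr>tA := False\<rparr>) Stay) (St r i (mk n (?c (n - 1)) (only 0) (only (n - 1)) u b j hm) (n - 1) C k y)
    (St r i (mk n (?c n) (only 0) (only (n - 1)) u b j hm) (n - 1) C k y)"
    using exec_edit_row[OF assms(1,2), of "\<lambda>w. w\<lparr>tA := False\<rparr>" Stay r "mk n (?c (n - 1)) (only 0) (only (n - 1)) u b j hm" "n - 1" y] assms(3)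
      up[of "n - 1"] by simp
  have c: "mk n (?c n) (only 0) (only (n - 1)) u b j hm = mk n never (only 0) (only (n - 1)) u b j hm"
    by (rule mk_cong) (simp add: never_def)
  have 3: "exec x rewind (St r i (mk n (?c n) (only 0) (only (n - 1)) u b j hm) (n - 1) C k y)
     (St r i (mk n never (only 0) (only (n - 1)) u b j hm) 0 C k y)"
    unfolding c using assms by (intro exec_rewind_mk) auto
  show ?thesis unfolding clear_A_def
    using exec_Seq[OF loop[OF assms(3)] exec_Seq[OF 2 3]] by simp
qed

section \<open>A binary counter\<close>

fun bin :: "nat \<Rightarrow> nat \<Rightarrow> bool list" where
  "bin 0 v = []"
| "bin (Suc n) v = odd v # bin n (v div 2)"

lemma length_bin [simp]: "length (bin n v) = n"
  by (induction n arbitrary: v) auto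

lemma bin_Suc:
  "Suc v < 2 ^ n \<Longrightarrow> \<exists>p rest w. bin n v = replicate p True @ False # rest \<and>
     bin n (Suc v) = replicate p False @ True # rest \<and> Suc v = 2 ^ p * (1 + 2 * w)"
proof (induction n arbitrary: v)
  case 0
  then show ?case by simp
next
  case (Suc n)
  show ?case
  proof (cases "even v")
    case True
    then show ?thesis
      by (intro exI[of _ 0] exI[of _ "bin n (v div 2)"] exI[of _ "v div 2"]) auto
  next
    case False
    then obtain v' where v: "v = 2 * v' + 1" by (auto elim: oddE)
    then have "Suc v' < 2 ^ n" using Suc.prems by simp
    from Suc.IH[OF this] obtain p rest w where
      "bin n v' = replicate p True @ False # rest" "bin n (Suc v') = replicate p False @ True # rest"
      "Suc v' = 2 ^ p * (1 + 2 * w)" by blast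
    then show ?thesis using v
      by (intro exI[of _ "Suc p"] exI[of _ rest] exI[of _ w]) auto
  qed
qed

definition increment :: "'r prog" where
  "increment = While (\<lambda>r i w b. tB w) (edit_row (\<lambda>w. w\<lparr>tB := False, tU := True\<rparr>) Rgt) ;;
     edit_row (\<lambda>w. w\<lparr>tB := True, tU := True\<rparr>) Stay ;; rewind"

definition counter_rows :: "nat \<Rightarrow> nat \<Rightarrow> row list" where
  "counter_rows n v = mk n (below n) (only 0) (only (n - 1)) (\<lambda>i. 2 ^ i \<le> v) (\<lambda>i. bin n v ! i) never never"

lemma bin_0: "i < n \<Longrightarrow> \<not> bin n 0 ! i"
  by (induction n arbitrary: i) (auto simp: less_Suc_eq_0_disj)

lemma counter_rows_0: "mk n (below n) (only 0) (only (n - 1)) never never never never = counter_rows n 0"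
  unfolding counter_rows_def by (rule mk_cong) (auto simp: never_def bin_0)

lemma exec_increment:
  assumes "i \<le> length x + 1" "k \<le> length C - 1" "Suc v < 2 ^ n"
  shows "exec x increment (St r i (counter_rows n v) 0 C k y) (St r i (counter_rows n (Suc v)) 0 C k y)"
proof -
  obtain p rest w where p: "bin n v = replicate p True @ False # rest"
      "bin n (Suc v) = replicate p False @ True # rest" "Suc v = 2 ^ p * (1 + 2 * w)"
    using bin_Suc[OF assms(3)] by blast
  have pn: "p < n" using arg_cong[OF p(1), of length] by simp
  let ?b = "\<lambda>t i. \<not> i < t \<and> bin n v ! i" and ?u = "\<lambda>t i. i < t \<or> 2 ^ i \<le> v"
  have up: "(?b t)(t := False) = ?b (Suc t)" "(?u t)(t := True) = ?u (Suc t)" for t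
    by (auto simp: less_Suc_eq fun_eq_iff)
  have bt: "bin n v ! t" if "t < p" for t using that by (simp add: p(1) nth_append)
  have bp: "\<not> bin n v ! p" by (simp add: p(1) nth_append)
  let ?W = "\<lambda>t. mk n (below n) (only 0) (only (n - 1)) (?u t) (?b t) never never"
  have loop: "exec x (While (\<lambda>r i w b. tB w) (edit_row (\<lambda>w. w\<lparr>tB := False, tU := True\<rparr>) Rgt))
    (St r i (?W t) t C k y) (St r i (?W p) p C k y)" if "t \<le> p" for t
    using that
  proof (induction "p - t" arbitrary: t)
    case 0
    then have "t = p" by simp
    then show ?case using pn bp by (simp add: exec_WhileF)
  next
    case (Suc q)
    have lt: "t < p" using Suc.hyps(2) by simp
    have 1: "exec x (edit_row (\<lambda>w. w\<lparr>tB := False, tU := True\<rparr>) Rgt) (St r i (?W t) t C k y) (St r i (?W (Suc t)) (Suc t) C k y)"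
      using exec_edit_row[OF assms(1,2), of "\<lambda>w. w\<lparr>tB := False, tU := True\<rparr>" Rgt r "?W t" t y] lt pn
      by (simp add: up min.absorb1)
    have t: "test x (\<lambda>r i w b. tB w) (St r i (?W t) t C k y)" using lt pn bt by simp
    show ?case using exec_WhileT[OF t 1] Suc.hyps(1)[of "Suc t"] lt Suc.hyps(2) by simp
  qed
  have W0: "counter_rows n v = ?W 0" by (simp add: counter_rows_def)
  have 2: "exec x (edit_row (\<lambda>w. w\<lparr>tB := True, tU := True\<rparr>) Stay) (St r i (?W p) p C k y)
     (St r i (mk n (below n) (only 0) (only (n - 1)) ((?u p)(p := True)) ((?b p)(p := True)) never never) p C k y)"
    using exec_edit_row[OF assms(1,2), of "\<lambda>w. w\<lparr>tB := True, tU := True\<rparr>" Stay r "?W p" p y] pn by simp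
  have c: "mk n (below n) (only 0) (only (n - 1)) ((?u p)(p := True)) ((?b p)(p := True)) never never = counter_rows n (Suc v)"
    unfolding counter_rows_def
  proof (rule mk_cong, intro conjI refl)
    fix i assume i: "i < n"
    show "((?b p)(p := True)) i = bin n (Suc v) ! i"
      by (auto simp: p(1,2) nth_append)
    show "((?u p)(p := True)) i = (2 ^ i \<le> Suc v)"
    proof (cases "i \<le> p")
      case True
      then have "(2::nat) ^ i \<le> 2 ^ p" by simp
      also have "\<dots> \<le> Suc v" unfolding p(3) by simp
      finally show ?thesis using True by auto
    next
      case False
      then obtain d where d: "i = Suc (p + d)" using less_imp_Suc_add by force
      have "Suc v \<noteq> 2 ^ i"
      proof
        assume "Suc v = 2 ^ i"
        then have "2 ^ p * (1 + 2 * w) = 2 ^ p * (2 * 2 ^ d)" using p(3) by (simp add: d power_add)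
        then have "1 + 2 * w = 2 * 2 ^ d" by (subst (asm) nat_mult_eq_cancel1) auto
        then show False by (metis even_mult_iff even_plus_one_iff add.commute dvd_triv_left)
      qed
      then show ?thesis using False by auto
    qed
  qed
  have 3: "exec x rewind (St r i (counter_rows n (Suc v)) p C k y) (St r i (counter_rows n (Suc v)) 0 C k y)"
    unfolding counter_rows_def by (rule exec_rewind_mk[OF assms(1,2) pn])
  show ?thesis unfolding increment_def W0
    by (rule exec_Seq[OF loop[OF le0] exec_Seq[OF 2[unfolded c] 3]])
qed


section \<open>Finding the ends of the catalytic tape\<close>

text \<open>
  \<open>rq\<close> is the simulated state and \<open>ro\<close> the last simulated output; \<open>rb\<close>, \<open>rw\<close>, \<open>rc\<close> buffer the work bit and
  the two head moves of a simulated step; \<open>ru\<close>, \<open>rv\<close>, \<open>rr\<close> hold the three catalytic bits displaced by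
  a probe; \<open>rf\<close> is set once all columns have failed; \<open>rp\<close> is the prefix of the input.
\<close>

record regs =
  rq :: nat
  rb :: bool
  rw :: dir
  rc :: dir
  ro :: out
  ru :: bool
  rv :: bool
  rr :: bool
  rf :: bool
  rp :: "bool list"

definition skip :: "'r prog" where
  "skip = move Stay Stay Stay"

fun opposite :: "dir \<Rightarrow> dir" where
  "opposite Lft = Rgt"
| "opposite Stay = Stay"
| "opposite Rgt = Lft"

definition put :: "(regs \<Rightarrow> bool) \<Rightarrow> dir \<Rightarrow> regs prog" where
  "put f d = Prim (\<lambda>r i w b. (r, w, f r, Stay, Stay, d, None))"

text \<open>
  A probe from cell \<open>h\<close> writes 1, 0 on the cell behind \<open>h\<close> and on \<open>h\<close>, steps ahead, writes 1 and steps
  back. If the step ahead moved, the head is back on \<open>h\<close> and reads 0; if it was clamped, the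
  1 overwrote \<open>h\<close> and the head reads the 1 behind it.
\<close>

definition probe :: "dir \<Rightarrow> regs prog" where
  "probe d = move Stay Stay (opposite d) ;;
     Prim (\<lambda>r i w b. (r\<lparr>ru := b\<rparr>, w, True, Stay, Stay, d, None)) ;;
     Prim (\<lambda>r i w b. (r\<lparr>rv := b\<rparr>, w, False, Stay, Stay, d, None)) ;;
     Prim (\<lambda>r i w b. (r\<lparr>rr := b\<rparr>, w, True, Stay, Stay, opposite d, None))"

definition unprobe :: "dir \<Rightarrow> regs prog" where
  "unprobe d = put rv (opposite d) ;; put ru d ;; move Stay Stay d ;; put rr Stay"

definition unprobe_end :: "dir \<Rightarrow> regs prog" where
  "unprobe_end d = put ru d ;; put rv Stay"

definition to_end :: "dir \<Rightarrow> regs prog \<Rightarrow> regs prog" where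
  "to_end d body = probe d ;; While (\<lambda>r i w b. \<not> b) (unprobe d ;; body ;; probe d) ;; unprobe_end d"

lemma exec_skip:
  assumes "i \<le> length x + 1" "k \<le> length C - 1" "h < length W"
  shows "exec x skip (St r i W h C k y) (St r i W h C k y)"
  unfolding skip_def using exec_move[of x Stay Stay Stay r i W h C k y] assms by (simp add: min.absorb1)

lemma exec_put:
  assumes "i \<le> length x + 1" "h < length W"
  shows "exec x (put f d) (St r i W h C k y) (St r i W h (C[k := f r]) (mv d k (length C - 1)) y)"
  unfolding put_def using assms by (intro exec_Prim) (simp add: min.absorb1)

lemma exec_probe_Rgt:
  assumes "i \<le> length x + 1" "t < length W" "Suc (Suc h) < length C"
  shows "exec x (probe Rgt) (St r i W t C (Suc h) y)
    (St (r\<lparr>ru := C ! h, rv := C ! Suc h, rr := C ! Suc (Suc h)\<rparr>) i W t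
       (C[h := True, Suc h := False, Suc (Suc h) := True]) (Suc h) y)"
  unfolding probe_def move_def using assms
  by (intro exec_Prim_Seq exec_Prim) (simp add: min.absorb1 rd_def)

lemma exec_probe_Rgt_end:
  assumes "i \<le> length x + 1" "t < length W" "length C = Suc (Suc h)"
  shows "exec x (probe Rgt) (St r i W t C (Suc h) y)
    (St (r\<lparr>ru := C ! h, rv := C ! Suc h, rr := False\<rparr>) i W t (C[h := True, Suc h := True]) h y)"
  unfolding probe_def move_def using assms
  by (intro exec_Prim_Seq exec_Prim) (simp add: min.absorb1 rd_def)

lemma exec_probe_Lft:
  assumes "i \<le> length x + 1" "t < length W" "Suc (Suc h) < length C"
  shows "exec x (probe Lft) (St r i W t C (Suc h) y)
    (St (r\<lparr>ru := C ! Suc (Suc h), rv := C ! Suc h, rr := C ! h\<rparr>) i W t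
       (C[Suc (Suc h) := True, Suc h := False, h := True]) (Suc h) y)"
  unfolding probe_def move_def using assms
  by (intro exec_Prim_Seq exec_Prim) (simp add: min.absorb1 rd_def)

lemma two_cells:
  assumes "Suc 0 < length C"
  obtains a b D where "C = a # b # D"
  using assms by (metis Suc_le_length_iff Suc_leI)

lemma exec_probe_Lft_end:
  assumes "i \<le> length x + 1" "t < length W" "Suc 0 < length C"
  shows "exec x (probe Lft) (St r i W t C 0 y)
    (St (r\<lparr>ru := C ! Suc 0, rv := C ! 0, rr := False\<rparr>) i W t (C[Suc 0 := True, 0 := True]) (Suc 0) y)"
proof -
  obtain a b D where "C = a # b # D" using two_cells[OF assms(3)] .
  then show ?thesis
    unfolding probe_def move_def using assms
    by (intro exec_Prim_Seq exec_Prim) (simp add: min.absorb1 rd_def)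
qed

lemma exec_unprobe_Rgt:
  assumes "i \<le> length x + 1" "t < length W" "Suc (Suc h) < length C"
    and "ru r = C ! h" "rv r = C ! Suc h" "rr r = C ! Suc (Suc h)"
  shows "exec x (unprobe Rgt) (St r i W t (C[h := True, Suc h := False, Suc (Suc h) := True]) (Suc h) y)
    (St r i W t C (Suc (Suc h)) y)"
proof -
  have "C[h := True, Suc h := False, Suc (Suc h) := True, Suc h := C ! Suc h, h := C ! h, Suc (Suc h) := C ! Suc (Suc h)] = C"
    using assms(3) by (intro nth_equalityI) (auto simp: nth_list_update)
  then show ?thesis
    unfolding unprobe_def put_def move_def using assms
    by (intro exec_Prim_Seq exec_Prim) (simp add: min.absorb1)
qed

lemma exec_unprobe_Lft:
  assumes "i \<le> length x + 1" "t < length W" "Suc (Suc h) < length C"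
    and "ru r = C ! Suc (Suc h)" "rv r = C ! Suc h" "rr r = C ! h"
  shows "exec x (unprobe Lft) (St r i W t (C[Suc (Suc h) := True, Suc h := False, h := True]) (Suc h) y)
    (St r i W t C h y)"
proof -
  have "C[Suc (Suc h) := True, Suc h := False, h := True, Suc h := C ! Suc h, Suc (Suc h) := C ! Suc (Suc h), h := C ! h] = C"
    using assms(3) by (intro nth_equalityI) (auto simp: nth_list_update)
  then show ?thesis
    unfolding unprobe_def put_def move_def using assms
    by (intro exec_Prim_Seq exec_Prim) (simp add: min.absorb1)
qed

lemma exec_to_end_Rgt:
  assumes "i \<le> length x + 1" "\<And>t. 0 < length (Wf t)"
    and body: "\<And>r k t. t < N \<Longrightarrow> k \<le> length C - 1 \<Longrightarrow>
      exec x body (St r i (Wf t) 0 C k y) (St r i (Wf (Suc t)) 0 C k y)"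
    and "Suc h < length C" "t + (length C - 2 - h) \<le> N"
  shows "\<exists>a b e. exec x (to_end Rgt body) (St r i (Wf t) 0 C (Suc h) y)
    (St (r\<lparr>ru := a, rv := b, rr := e\<rparr>) i (Wf (t + (length C - 2 - h))) 0 C (length C - 1) y)"
  using assms(4,5)
proof (induction "length C - 2 - h" arbitrary: h t r)
  case 0
  then have l: "length C = Suc (Suc h)" by simp
  let ?r = "r\<lparr>ru := C ! h, rv := C ! Suc h, rr := False\<rparr>" and ?C = "C[h := True, Suc h := True]"
  have c: "C[h := True, Suc h := True, h := C ! h, Suc h := C ! Suc h] = C"
    using l by (intro nth_equalityI) (auto simp: nth_list_update)
  have nt: "\<not> test x (\<lambda>r i w b. \<not> b) (St ?r i (Wf t) 0 ?C h y)"
    using l by (simp add: rd_def)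
  have 3: "exec x (unprobe_end Rgt) (St ?r i (Wf t) 0 ?C h y) (St ?r i (Wf t) 0 C (Suc h) y)"
    unfolding unprobe_end_def put_def using assms(1) assms(2)[of t] l c
    by (intro exec_Prim_Seq exec_Prim) (simp add: min.absorb1)
  show ?case unfolding to_end_def
    using exec_Seq[OF exec_probe_Rgt_end[OF assms(1,2) l] exec_Seq[OF exec_WhileF[OF nt] 3]] l by auto
next
  case (Suc n)
  have l: "Suc (Suc h) < length C" using Suc.hyps(2) by simp
  have n: "n = length C - 2 - Suc h" and tl: "t < N" "Suc t + (length C - 2 - Suc h) \<le> N"
    using Suc.hyps(2) Suc.prems(2) by auto
  let ?r = "r\<lparr>ru := C ! h, rv := C ! Suc h, rr := C ! Suc (Suc h)\<rparr>"
  let ?S0 = "St ?r i (Wf t) 0 (C[h := True, Suc h := False, Suc (Suc h) := True]) (Suc h) y"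
  let ?w = "While (\<lambda>r i w b. \<not> b) (unprobe Rgt ;; body ;; probe Rgt)"
  have 1: "exec x (probe Rgt) (St r i (Wf t) 0 C (Suc h) y) ?S0"
    by (rule exec_probe_Rgt[OF assms(1,2) l])
  have 2: "exec x (unprobe Rgt) ?S0 (St ?r i (Wf t) 0 C (Suc (Suc h)) y)"
    by (rule exec_unprobe_Rgt[OF assms(1,2) l]) auto
  have 3: "exec x body (St ?r i (Wf t) 0 C (Suc (Suc h)) y) (St ?r i (Wf (Suc t)) 0 C (Suc (Suc h)) y)"
    using l by (intro body tl(1)) simp
  obtain a b e where ih: "exec x (to_end Rgt body) (St ?r i (Wf (Suc t)) 0 C (Suc (Suc h)) y)
    (St (?r\<lparr>ru := a, rv := b, rr := e\<rparr>) i (Wf (Suc t + (length C - 2 - Suc h))) 0 C (length C - 1) y)" (is "exec x _ _ ?S'")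
    using Suc.hyps(1)[OF n l tl(2), of ?r] by blast
  obtain S2 S3 where S: "exec x (probe Rgt) (St ?r i (Wf (Suc t)) 0 C (Suc (Suc h)) y) S2"
    "exec x ?w S2 S3" "exec x (unprobe_end Rgt) S3 ?S'"
    using ih unfolding to_end_def by (elim exec_SeqE)
  have tst: "test x (\<lambda>r i w b. \<not> b) ?S0" using l by (simp add: rd_def)
  have "exec x ?w ?S0 S3"
    by (rule exec_WhileT[OF tst exec_Seq[OF 2 exec_Seq[OF 3 S(1)]] S(2)])
  then have "exec x (to_end Rgt body) (St r i (Wf t) 0 C (Suc h) y) ?S'"
    unfolding to_end_def using exec_Seq[OF 1 exec_Seq[OF _ S(3)]] by blast
  moreover have "Suc t + (length C - 2 - Suc h) = t + (length C - 2 - h)" using Suc.hyps(2) by simp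
  ultimately show ?case by (auto simp del: add_Suc)
qed

lemma exec_to_end_Lft:
  assumes "i \<le> length x + 1" "0 < length W" "Suc h < length C"
  shows "\<exists>a b e. exec x (to_end Lft skip) (St r i W 0 C h y)
    (St (r\<lparr>ru := a, rv := b, rr := e\<rparr>) i W 0 C 0 y)"
  using assms(3)
proof (induction h arbitrary: r)
  case 0
  let ?r = "r\<lparr>ru := C ! Suc 0, rv := C ! 0, rr := False\<rparr>" and ?C = "C[Suc 0 := True, 0 := True]"
  obtain u v D where C: "C = u # v # D" using two_cells[OF 0] .
  have nt: "\<not> test x (\<lambda>r i w b. \<not> b) (St ?r i W 0 ?C (Suc 0) y)"
    using C by (simp add: rd_def)
  have 3: "exec x (unprobe_end Lft) (St ?r i W 0 ?C (Suc 0) y) (St ?r i W 0 C 0 y)"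
    unfolding unprobe_end_def put_def using assms(1,2) C
    by (intro exec_Prim_Seq exec_Prim) (simp add: min.absorb1 rd_def)
  show ?case unfolding to_end_def
    using exec_Seq[OF exec_probe_Lft_end[OF assms(1,2) 0] exec_Seq[OF exec_WhileF[OF nt] 3]] by auto
next
  case (Suc h)
  let ?r = "r\<lparr>ru := C ! Suc (Suc h), rv := C ! Suc h, rr := C ! h\<rparr>"
  let ?S0 = "St ?r i W 0 (C[Suc (Suc h) := True, Suc h := False, h := True]) (Suc h) y"
  let ?w = "While (\<lambda>r i w b. \<not> b) (unprobe Lft ;; skip ;; probe Lft)"
  have 1: "exec x (probe Lft) (St r i W 0 C (Suc h) y) ?S0"
    by (rule exec_probe_Lft[OF assms(1,2) Suc.prems])
  have 2: "exec x (unprobe Lft) ?S0 (St ?r i W 0 C h y)"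
    by (rule exec_unprobe_Lft[OF assms(1,2) Suc.prems]) auto
  have 3: "exec x skip (St ?r i W 0 C h y) (St ?r i W 0 C h y)"
    using Suc.prems assms by (intro exec_skip) auto
  obtain a b e where ih: "exec x (to_end Lft skip) (St ?r i W 0 C h y)
    (St (?r\<lparr>ru := a, rv := b, rr := e\<rparr>) i W 0 C 0 y)" (is "exec x _ _ ?S'")
    using Suc.IH[of ?r] Suc.prems by auto
  obtain S2 S3 where S: "exec x (probe Lft) (St ?r i W 0 C h y) S2"
    "exec x ?w S2 S3" "exec x (unprobe_end Lft) S3 ?S'"
    using ih unfolding to_end_def by (elim exec_SeqE)
  have tst: "test x (\<lambda>r i w b. \<not> b) ?S0" using Suc.prems by (simp add: rd_def)
  have "exec x ?w ?S0 S3"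
    by (rule exec_WhileT[OF tst exec_Seq[OF 2 exec_Seq[OF 3 S(1)]] S(2)])
  then have "exec x (to_end Lft skip) (St r i W 0 C (Suc h) y) ?S'"
    unfolding to_end_def using exec_Seq[OF 1 exec_Seq[OF _ S(3)]] by blast
  then show ?case by auto
qed

section \<open>Interleaved columns of the catalytic tape\<close>

definition col :: "nat \<Rightarrow> nat \<Rightarrow> nat \<Rightarrow> bool list \<Rightarrow> bool list" where
  "col m c j C = map (\<lambda>p. C ! (p * m + j)) [0..<c]"

definition put_col :: "nat \<Rightarrow> nat \<Rightarrow> bool list \<Rightarrow> bool list \<Rightarrow> bool list" where
  "put_col m j \<tau> C = map (\<lambda>i. if i mod m = j then \<tau> ! (i div m) else C ! i) [0..<length C]"

lemma length_col [simp]: "length (col m c j C) = c"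
  by (simp add: col_def)

lemma length_put_col [simp]: "length (put_col m j \<tau> C) = length C"
  by (simp add: put_col_def)

lemma cell_less:
  fixes p c j m :: nat
  assumes "p < c" "j < m"
  shows "p * m + j < c * m"
proof -
  have "p * m + j < Suc p * m" using assms by simp
  also have "\<dots> \<le> c * m" using assms by (intro mult_le_mono1) simp
  finally show ?thesis .
qed

lemma home_le:
  fixes p c m l :: nat
  assumes "p < c" "0 < m" "l = c * m"
  shows "p * m \<le> l - 1"
  using cell_less[OF assms(1,2)] assms(3) by linarith

lemma nth_put_col:
  assumes "length C = c * m" "p < c" "j < m"
  shows "put_col m j \<tau> C ! (p * m + j) = \<tau> ! p"
  using cell_less[OF assms(2,3)] assms by (simp add: put_col_def)

lemma put_col_update:
  assumes "length C = c * m" "p < c" "j < m" "length \<tau> = c"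
  shows "(put_col m j \<tau> C)[p * m + j := b] = put_col m j (\<tau>[p := b]) C"
proof (rule nth_equalityI)
  fix i assume "i < length ((put_col m j \<tau> C)[p * m + j := b])"
  then have i: "i < c * m" using assms by simp
  have eq: "i = p * m + j \<longleftrightarrow> i mod m = j \<and> i div m = p"
    using assms(3) by auto
  show "(put_col m j \<tau> C)[p * m + j := b] ! i = put_col m j (\<tau>[p := b]) C ! i"
    using i assms cell_less[OF assms(2,3)] eq by (auto simp: put_col_def nth_list_update)
qed simp

lemma put_col_col:
  assumes "length C = c * m"
  shows "put_col m j (col m c j C) C = C"
proof (rule nth_equalityI)
  fix i assume "i < length (put_col m j (col m c j C) C)"
  then have i: "i < c * m" using assms by simp
  then have "i div m < c" by (simp add: less_mult_imp_div_less)
  then show "put_col m j (col m c j C) C ! i = C ! i"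
    using i assms by (auto simp: put_col_def col_def)
qed simp

definition jump :: "dir \<Rightarrow> 'r prog" where
  "jump d = scan (\<lambda>w. \<not> tJ w) d ;; rewind"

definition stride :: "dir \<Rightarrow> 'r prog" where
  "stride d = scan tU d ;; rewind"

definition stride_pred :: "dir \<Rightarrow> 'r prog" where
  "stride_pred d = move Stay Rgt Stay ;; scan tU d ;; rewind"

definition row_right :: "'r prog" where
  "row_right = stride Rgt ;; stride_pred Rgt ;; stride_pred Lft"

lemma exec_jump:
  assumes "i \<le> length x + 1" "k \<le> length C - 1" "j < n"
  shows "exec x (jump d) (St r i (mk n a (only 0) e u b (only j) hm) 0 C k y)
    (St r i (mk n a (only 0) e u b (only j) hm) 0 C (((\<lambda>k. mv d k (length C - 1)) ^^ j) k) y)"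
proof -
  let ?W = "mk n a (only 0) e u b (only j) hm" and ?k = "((\<lambda>k. mv d k (length C - 1)) ^^ j) k"
  have k: "?k \<le> length C - 1" using assms(2) by (induction j) (auto intro: mv_le)
  have 1: "exec x (scan (\<lambda>w. \<not> tJ w) d) (St r i ?W 0 C k y) (St r i ?W j C ?k y)"
    using exec_scan[OF assms(1,2), of 0 j "\<lambda>w. \<not> tJ w" ?W d r y] assms(3) by (simp add: only_def)
  show ?thesis unfolding jump_def
    by (rule exec_Seq[OF 1 exec_rewind_mk[OF assms(1) k assms(3)]])
qed

lemma exec_jump_Rgt:
  assumes "i \<le> length x + 1" "k + j < length C" "j < n"
  shows "exec x (jump Rgt) (St r i (mk n a (only 0) e u b (only j) hm) 0 C k y)
    (St r i (mk n a (only 0) e u b (only j) hm) 0 C (k + j) y)"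
  using exec_jump[OF assms(1) _ assms(3), of k C Rgt r a e u b hm y] assms(2)
  by (simp add: funpow_mv_Rgt del: mv.simps)

lemma exec_jump_Lft:
  assumes "i \<le> length x + 1" "k < length C" "j < n"
  shows "exec x (jump Lft) (St r i (mk n a (only 0) e u b (only j) hm) 0 C k y)
    (St r i (mk n a (only 0) e u b (only j) hm) 0 C (k - j) y)"
  using exec_jump[OF assms(1) _ assms(3), of k C Lft r a e u b hm y] assms(2)
  by (simp add: funpow_mv_Lft del: mv.simps)

lemma exec_stride:
  assumes "i \<le> length x + 1" "k \<le> length C - 1" "m < n"
  shows "exec x (stride d) (St r i (mk n a (only 0) e (below m) b j hm) 0 C k y)
    (St r i (mk n a (only 0) e (below m) b j hm) 0 C (((\<lambda>k. mv d k (length C - 1)) ^^ m) k) y)"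
proof -
  let ?W = "mk n a (only 0) e (below m) b j hm" and ?k = "((\<lambda>k. mv d k (length C - 1)) ^^ m) k"
  have k: "?k \<le> length C - 1" using assms(2) by (induction m) (auto intro: mv_le)
  have 1: "exec x (scan tU d) (St r i ?W 0 C k y) (St r i ?W m C ?k y)"
    using exec_scan[OF assms(1,2), of 0 m tU ?W d r y] assms(3) by (simp add: below_def)
  show ?thesis unfolding stride_def
    by (rule exec_Seq[OF 1 exec_rewind_mk[OF assms(1) k assms(3)]])
qed

lemma exec_stride_pred:
  assumes "i \<le> length x + 1" "k \<le> length C - 1" "m < n" "0 < m"
  shows "exec x (stride_pred d) (St r i (mk n a (only 0) e (below m) b j hm) 0 C k y)
    (St r i (mk n a (only 0) e (below m) b j hm) 0 C (((\<lambda>k. mv d k (length C - 1)) ^^ (m - 1)) k) y)"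
proof -
  let ?W = "mk n a (only 0) e (below m) b j hm" and ?k = "((\<lambda>k. mv d k (length C - 1)) ^^ (m - 1)) k"
  have k: "((\<lambda>k. mv d k (length C - 1)) ^^ l) k \<le> length C - 1" for l
    using assms(2) by (induction l) (auto intro: mv_le)
  have 0: "exec x (move Stay Rgt Stay) (St r i ?W 0 C k y) (St r i ?W 1 C k y)"
    using exec_move[of x Stay Rgt Stay r i ?W 0 C k y] assms by (simp add: min.absorb1)
  have 1: "exec x (scan tU d) (St r i ?W 1 C k y) (St r i ?W m C ?k y)"
    using exec_scan[OF assms(1,2), of 1 m tU ?W d r y] assms(3,4) by (simp add: below_def)
  show ?thesis unfolding stride_pred_def
    by (rule exec_Seq[OF 0 exec_Seq[OF 1 exec_rewind_mk[OF assms(1) k assms(3)]]])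
qed

lemma exec_row_left:
  assumes "i \<le> length x + 1" "length C = c * m" "p < c" "0 < m" "m < n"
  shows "exec x (stride Lft) (St r i (mk n a (only 0) e (below m) b j hm) 0 C (p * m) y)
    (St r i (mk n a (only 0) e (below m) b j hm) 0 C ((p - 1) * m) y)"
  using exec_stride[OF assms(1) home_le[OF assms(3,4,2)] assms(5), of Lft r a e b j hm y]
  by (simp add: funpow_mv_Lft diff_mult_distrib del: mv.simps)

lemma exec_row_right:
  assumes "i \<le> length x + 1" "length C = c * m" "p < c" "0 < m" "m < n"
  shows "exec x row_right (St r i (mk n a (only 0) e (below m) b j hm) 0 C (p * m) y)
    (St r i (mk n a (only 0) e (below m) b j hm) 0 C (min (Suc p) (c - 1) * m) y)"
proof -
  let ?W = "mk n a (only 0) e (below m) b j hm" and ?k1 = "min (p * m + m) (c * m - 1)"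
  let ?k2 = "min (?k1 + (m - 1)) (c * m - 1)"
  have l: "p * m \<le> length C - 1" by (rule home_le[OF assms(3,4,2)])
  have 1: "exec x (stride Rgt) (St r i ?W 0 C (p * m) y) (St r i ?W 0 C ?k1 y)"
    using exec_stride[OF assms(1) l assms(5), of Rgt r a e b j hm y] l assms(2)
    by (simp add: funpow_mv_Rgt del: mv.simps)
  have 2: "exec x (stride_pred Rgt) (St r i ?W 0 C ?k1 y) (St r i ?W 0 C ?k2 y)"
    using exec_stride_pred[OF assms(1) _ assms(5,4), of ?k1 C Rgt r a e b j hm y] assms(2)
    by (simp add: funpow_mv_Rgt del: mv.simps)
  have 3: "exec x (stride_pred Lft) (St r i ?W 0 C ?k2 y) (St r i ?W 0 C (?k2 - (m - 1)) y)"
    using exec_stride_pred[OF assms(1) _ assms(5,4), of ?k2 C Lft r a e b j hm y] assms(2)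
    by (simp add: funpow_mv_Lft del: mv.simps)
  have "?k2 - (m - 1) = min (Suc p) (c - 1) * m"
  proof (cases "Suc p < c")
    case True
    then obtain d where c: "c = Suc (Suc p) + d" by (metis less_iff_Suc_add add_Suc)
    have "c * m = p * m + m + m + d * m" unfolding c by (simp add: algebra_simps)
    then show ?thesis using assms(4) c by (auto simp: min_def)
  next
    case False
    then have c: "c = Suc p" using assms(3) by simp
    show ?thesis using assms(4) unfolding c by (auto simp: min_def)
  qed
  then show ?thesis unfolding row_right_def
    using exec_Seq[OF 1 exec_Seq[OF 2 3]] by simp
qed

definition cat_move :: "regs prog" where
  "cat_move = Cond (\<lambda>r i w b. rc r = Rgt) row_right (Cond (\<lambda>r i w b. rc r = Lft) (stride Lft) skip)"

lemma exec_cat_move: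
  assumes "i \<le> length x + 1" "length C = c * m" "p < c" "0 < m" "m < n"
  shows "exec x cat_move (St r i (mk n a (only 0) e (below m) b j hm) 0 C (p * m) y)
    (St r i (mk n a (only 0) e (below m) b j hm) 0 C (mv (rc r) p (c - 1) * m) y)"
proof (cases "rc r")
  case Lft
  then show ?thesis unfolding cat_move_def using exec_row_left[OF assms]
    by (intro exec_IfF exec_IfT) auto
next
  case Stay
  have "mv Stay p (c - 1) = p" using assms(3) by simp
  moreover have "exec x skip (St r i (mk n a (only 0) e (below m) b j hm) 0 C (p * m) y)
      (St r i (mk n a (only 0) e (below m) b j hm) 0 C (p * m) y)"
    by (rule exec_skip[OF assms(1) home_le[OF assms(3,4,2)]]) (use assms(5) in simp)
  ultimately show ?thesis unfolding cat_move_def using Stay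
    by (intro exec_IfF) auto
next
  case Rgt
  then show ?thesis unfolding cat_move_def using exec_row_right[OF assms]
    by (intro exec_IfT) auto
qed

definition work_move :: "regs prog" where
  "work_move = Cond (\<lambda>r i w b. rw r = Rgt)
      (move Stay Rgt Stay ;; move Stay Rgt Stay ;; move Stay Rgt Stay ;; move Stay Lft Stay)
      (Cond (\<lambda>r i w b. rw r = Lft) (move Stay Lft Stay ;; move Stay Lft Stay) skip)"

lemma exec_work_move:
  assumes "i \<le> length x + 1" "k \<le> length C - 1" "h < s" "length W = 2 * s"
  shows "exec x work_move (St r i W (2 * h) C k y) (St r i W (2 * mv (rw r) h (s - 1)) C k y)"
proof (cases "rw r")
  case Lft
  have "exec x (move Stay Lft Stay ;; move Stay Lft Stay) (St r i W (2 * h) C k y) (St r i W (2 * (h - 1)) C k y)"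
    unfolding move_def using assms by (intro exec_Prim_Seq exec_Prim) (simp add: min.absorb1)
  then show ?thesis unfolding work_move_def using Lft
    by (intro exec_IfF exec_IfT) auto
next
  case Stay
  then show ?thesis unfolding work_move_def using assms
    by (intro exec_IfF) (auto simp: min.absorb1 intro!: exec_skip)
next
  case Rgt
  let ?hi = "2 * s - 1"
  have mR: "exec x (move Stay Rgt Stay) (St r i W t C k y) (St r i W (min (Suc t) ?hi) C k y)" for t
    using exec_move[of x Stay Rgt Stay r i W t C k y] assms by (simp add: min.absorb1)
  have mL: "exec x (move Stay Lft Stay) (St r i W t C k y) (St r i W (t - 1) C k y)" for t
    using exec_move[of x Stay Lft Stay r i W t C k y] assms by (simp add: min.absorb1)
  have "min (Suc (min (Suc (min (Suc (2 * h)) ?hi)) ?hi)) ?hi - 1 = 2 * min (Suc h) (s - 1)"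
  proof (cases "Suc h < s")
    case True
    then show ?thesis by simp
  next
    case False
    then have "s = Suc h" using assms(3) by simp
    then show ?thesis by simp
  qed
  then have "exec x (move Stay Rgt Stay ;; move Stay Rgt Stay ;; move Stay Rgt Stay ;; move Stay Lft Stay)
      (St r i W (2 * h) C k y) (St r i W (2 * min (Suc h) (s - 1)) C k y)"
    using exec_Seq[OF mR exec_Seq[OF mR exec_Seq[OF mR mL]]] by metis
  then show ?thesis unfolding work_move_def using Rgt
    by (intro exec_IfT) auto
qed

definition sim_core :: "mach \<Rightarrow> regs prog" where
  "sim_core M = Prim (\<lambda>r i w b. case dlt M (rq r) i (rb r) b of (q, wb, cb, di, dw, dc, oo) \<Rightarrow>
     (r\<lparr>rq := q, rb := wb, rw := dw, rc := dc, ro := (case oo of None \<Rightarrow> ro r | Some sy \<Rightarrow> sy)\<rparr>,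
      w, cb, di, Stay, Stay, None))"

definition sim_step :: "mach \<Rightarrow> regs prog" where
  "sim_step M =
     Prim (\<lambda>r i w b. (r\<lparr>rb := tA w\<rparr>, w\<lparr>tH := True\<rparr>, b, Stay, Stay, Stay, None)) ;;
     rewind ;; jump Rgt ;; sim_core M ;; jump Lft ;; cat_move ;;
     scan (\<lambda>w. \<not> tH w) Stay ;;
     Prim (\<lambda>r i w b. (r, w\<lparr>tA := rb r, tH := False\<rparr>, b, Stay, Stay, Stay, None)) ;;
     work_move"

text \<open>Simulated work cell \<open>p\<close> lives on row \<open>2 * p\<close>: the spare odd rows make clamped moves to the
  right expressible as three moves right and one left, and they provide the \<open>2 * s\<close> rows needed to
  count the cells of the catalytic tape.\<close>

definition sim_rows :: "nat \<Rightarrow> nat \<Rightarrow> (nat \<Rightarrow> bool) \<Rightarrow> (nat \<Rightarrow> bool) \<Rightarrow> nat \<Rightarrow> row list" where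
  "sim_rows s m a b j = mk (2 * s) a (only 0) (only (2 * s - 1)) (below m) b (only j) never"

definition conf_ok :: "bool list \<Rightarrow> nat \<Rightarrow> nat \<Rightarrow> conf \<Rightarrow> bool" where
  "conf_ok x s c Z \<longleftrightarrow> length (wt Z) = s \<and> wh Z < s \<and> length (ct Z) = c \<and> ch Z < c \<and> ih Z \<le> length x + 1"

lemma conf_ok_step: "conf_ok x s c Z \<Longrightarrow> conf_ok x s c (step M x Z)"
  unfolding conf_ok_def step_def
  by (auto split: prod.splits intro!: mv_le le_less_trans[OF mv_le])

lemma exec_sim_step:
  assumes ok: "conf_ok x s c Z" and nh: "\<not> hlt M (st Z)"
    and m: "0 < m" "m < 2 * s" and j: "j < m" and C: "length C = c * m"
    and a: "\<And>p. p < s \<Longrightarrow> a (2 * p) = wt Z ! p" and q: "rq r = st Z"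
    and out: "ot Z = [] \<or> ro r = last (ot Z)"
  shows "\<exists>r' a'. exec x (sim_step M)
      (St r (ih Z) (sim_rows s m a b j) (2 * wh Z) (put_col m j (ct Z) C) (ch Z * m) y)
      (St r' (ih (step M x Z)) (sim_rows s m a' b j) (2 * wh (step M x Z))
         (put_col m j (ct (step M x Z)) C) (ch (step M x Z) * m) y) \<and>
    (\<forall>p < s. a' (2 * p) = wt (step M x Z) ! p) \<and> rq r' = st (step M x Z) \<and> rf r' = rf r \<and>
    (ot (step M x Z) = [] \<or> ro r' = last (ot (step M x Z)))"
proof -
  let ?Z = "step M x Z" and ?h = "2 * wh Z" and ?k = "ch Z * m"
  let ?C = "put_col m j (ct Z) C" and ?C' = "put_col m j (ct ?Z) C"
  let ?W = "\<lambda>a hm. mk (2 * s) a (only 0) (only (2 * s - 1)) (below m) b (only j) hm"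
  have rng: "length (wt Z) = s" "wh Z < s" "length (ct Z) = c" "ch Z < c" "ih Z \<le> length x + 1"
    using ok by (auto simp: conf_ok_def)
  have rng': "ih ?Z \<le> length x + 1" using conf_ok_step[OF ok, of M] by (simp add: conf_ok_def)
  have k: "?k + j < c * m" "?k < c * m" using cell_less[OF rng(4) j] by linarith+
  obtain q' wb cb di dw dc oo where d:
    "dlt M (st Z) (inp x (ih Z)) (wt Z ! wh Z) (ct Z ! ch Z) = (q', wb, cb, di, dw, dc, oo)"
    by (metis surj_pair)
  have stp: "?Z = Z\<lparr> st := q', ih := mv di (ih Z) (length x + 1), wt := (wt Z)[wh Z := wb],
            wh := mv dw (wh Z) (s - 1), ct := (ct Z)[ch Z := cb], ch := mv dc (ch Z) (c - 1),
            ot := ot Z @ (case oo of None \<Rightarrow> [] | Some sy \<Rightarrow> [sy]) \<rparr>"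
    using nh d rng by (simp add: step_def rd_def)
  let ?r1 = "r\<lparr>rb := a ?h\<rparr>"
  let ?r2 = "r\<lparr>rq := q', rb := wb, rw := dw, rc := dc, ro := (case oo of None \<Rightarrow> ro r | Some sy \<Rightarrow> sy)\<rparr>"
  let ?a = "a(?h := wb)"
  have h1: "never(?h := True) = only ?h" "(only ?h)(?h := False) = never"
    by (auto simp: never_def only_def fun_eq_iff)
  have e1: "exec x (Prim (\<lambda>r i w b. (r\<lparr>rb := tA w\<rparr>, w\<lparr>tH := True\<rparr>, b, Stay, Stay, Stay, None)))
     (St r (ih Z) (?W a never) ?h ?C ?k y) (St ?r1 (ih Z) (?W a (only ?h)) ?h ?C ?k y)"
    using rng k C by (intro exec_Prim) (simp add: h1 min.absorb1)
  have e2: "exec x rewind (St ?r1 (ih Z) (?W a (only ?h)) ?h ?C ?k y) (St ?r1 (ih Z) (?W a (only ?h)) 0 ?C ?k y)"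
    using rng k C by (intro exec_rewind_mk) auto
  have e3: "exec x (jump Rgt) (St ?r1 (ih Z) (?W a (only ?h)) 0 ?C ?k y) (St ?r1 (ih Z) (?W a (only ?h)) 0 ?C (?k + j) y)"
    using rng k C j m by (intro exec_jump_Rgt) auto
  have rdC: "rd ?C (?k + j) = ct Z ! ch Z"
    using k C nth_put_col[OF C rng(4) j] by (simp add: rd_def)
  have e4: "exec x (sim_core M) (St ?r1 (ih Z) (?W a (only ?h)) 0 ?C (?k + j) y)
      (St ?r2 (ih ?Z) (?W a (only ?h)) 0 ?C' (?k + j) y)"
    unfolding sim_core_def using d rdC q k C m a[OF rng(2)] put_col_update[OF C rng(4) j rng(3), of cb]
    by (intro exec_Prim) (simp add: stp min.absorb1 del: nth_mk split: option.split)
  have e5: "exec x (jump Lft) (St ?r2 (ih ?Z) (?W a (only ?h)) 0 ?C' (?k + j) y)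
      (St ?r2 (ih ?Z) (?W a (only ?h)) 0 ?C' ?k y)"
    using exec_jump_Lft[OF rng', of "?k + j" ?C' j "2 * s"] rng k C j m by simp
  have e6: "exec x cat_move (St ?r2 (ih ?Z) (?W a (only ?h)) 0 ?C' ?k y)
      (St ?r2 (ih ?Z) (?W a (only ?h)) 0 ?C' (ch ?Z * m) y)"
    using exec_cat_move[OF rng' _ rng(4) m, of ?C' ?r2 a "only (2 * s - 1)" b "only j" "only ?h" y] C
    by (simp add: stp)
  have k': "ch ?Z * m \<le> length ?C' - 1"
    using conf_ok_step[OF ok, of M] m C by (intro home_le[of _ c]) (auto simp: conf_ok_def)
  have e7: "exec x (scan (\<lambda>w. \<not> tH w) Stay) (St ?r2 (ih ?Z) (?W a (only ?h)) 0 ?C' (ch ?Z * m) y)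
      (St ?r2 (ih ?Z) (?W a (only ?h)) ?h ?C' (ch ?Z * m) y)"
    using exec_scan[OF rng' k', of 0 ?h "\<lambda>w. \<not> tH w" "?W a (only ?h)" Stay ?r2 y] rng(2) funpow_mv_Stay[OF k']
    by (simp add: only_def)
  have e8: "exec x (Prim (\<lambda>r i w b. (r, w\<lparr>tA := rb r, tH := False\<rparr>, b, Stay, Stay, Stay, None)))
      (St ?r2 (ih ?Z) (?W a (only ?h)) ?h ?C' (ch ?Z * m) y) (St ?r2 (ih ?Z) (?W ?a never) ?h ?C' (ch ?Z * m) y)"
    using rng rng' k' by (intro exec_Prim) (simp add: h1 min.absorb1)
  have e9: "exec x work_move (St ?r2 (ih ?Z) (?W ?a never) ?h ?C' (ch ?Z * m) y)
      (St ?r2 (ih ?Z) (?W ?a never) (2 * wh ?Z) ?C' (ch ?Z * m) y)"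
    using exec_work_move[OF rng' k' rng(2), of "?W ?a never" ?r2 y] by (simp add: stp)
  have "exec x (sim_step M) (St r (ih Z) (sim_rows s m a b j) ?h ?C ?k y)
      (St ?r2 (ih ?Z) (sim_rows s m ?a b j) (2 * wh ?Z) ?C' (ch ?Z * m) y)"
    unfolding sim_step_def sim_rows_def
    by (rule exec_Seq[OF e1 exec_Seq[OF e2 exec_Seq[OF e3 exec_Seq[OF e4 exec_Seq[OF e5
      exec_Seq[OF e6 exec_Seq[OF e7 exec_Seq[OF e8 e9]]]]]]]])
  moreover have "\<forall>p < s. ?a (2 * p) = wt ?Z ! p"
    using a rng by (auto simp: stp nth_list_update)
  moreover have "ot ?Z = [] \<or> ro ?r2 = last (ot ?Z)"
    using out by (auto simp: stp split: option.splits)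
  moreover have "rq ?r2 = st ?Z" "rf ?r2 = rf r" by (simp_all add: stp)
  ultimately show ?thesis by blast
qed

definition input_rewind :: "'r prog" where
  "input_rewind = move Lft Stay Stay ;; While (\<lambda>r i w b. i \<noteq> None) (move Lft Stay Stay)"

lemma exec_input_rewind:
  assumes "i \<le> length x + 1" "k \<le> length C - 1" "h < length W"
  shows "exec x input_rewind (St r i W h C k y) (St r 0 W h C k y)"
proof -
  have mv: "exec x (move Lft Stay Stay) (St r i W h C k y) (St r (i - 1) W h C k y)" for i
    using exec_move[of x Lft Stay Stay r i W h C k y] assms by (simp add: min.absorb1)
  have "exec x (While (\<lambda>r i w b. i \<noteq> None) (move Lft Stay Stay)) (St r i W h C k y) (St r 0 W h C k y)"
    if "i \<le> length x" for i
    using that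
  proof (induction i)
    case 0
    then show ?case by (intro exec_WhileF) (simp add: inp_def)
  next
    case (Suc i)
    have "test x (\<lambda>r i w b. i \<noteq> None) (St r (Suc i) W h C k y)" using Suc.prems by (simp add: inp_def)
    from exec_WhileT[OF this mv] show ?case using Suc by simp
  qed
  from exec_Seq[OF mv this] show ?thesis unfolding input_rewind_def using assms(1) by simp
qed

definition run :: "mach \<Rightarrow> regs prog" where
  "run M = input_rewind ;; clear_A ;;
     Prim (\<lambda>r i w b. (r\<lparr>rq := 0\<rparr>, w, b, Stay, Stay, Stay, None)) ;;
     While (\<lambda>r i w b. \<not> hlt M (rq r)) (sim_step M) ;; rewind ;; to_end Lft skip"

lemma exec_run:
  assumes hal: "halts M x s \<tau>" and \<tau>: "length \<tau> = c" and s: "0 < s" "0 < c"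
    and m: "2 \<le> m" "m < 2 * s" and j: "j < m" and C: "length C = c * m"
    and i: "i \<le> length x + 1" and out: "ot (final M x s \<tau>) \<noteq> []"
  shows "\<exists>r' i' a'. exec x (run M)
      (St r i (sim_rows s m a b j) 0 (put_col m j \<tau> C) 0 y)
      (St r' i' (sim_rows s m a' b j) 0 (put_col m j (ct (final M x s \<tau>)) C) 0 y) \<and>
    i' \<le> length x + 1 \<and> rf r' = rf r \<and> ro r' = last (ot (final M x s \<tau>))"
proof -
  let ?f = "\<lambda>t. (step M x ^^ t) (init x s \<tau>)"
  let ?C = "\<lambda>Z. put_col m j (ct Z) C"
  define T where "T = (LEAST t. hlt M (st (?f t)))"
  have T: "hlt M (st (?f T))" "\<And>t. t < T \<Longrightarrow> \<not> hlt M (st (?f t))"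
    using hal unfolding T_def halts_def by (auto intro: LeastI_ex dest: not_less_Least)
  have fin: "final M x s \<tau> = ?f T" by (simp add: final_def T_def)
  have ok: "conf_ok x s c (?f t)" for t
  proof (induction t)
    case 0
    then show ?case using \<tau> s by (simp add: conf_ok_def init_def)
  next
    case (Suc t)
    then show ?case by (simp add: conf_ok_step)
  qed
  have loop: "\<exists>r' a'. exec x (While (\<lambda>r i w b. \<not> hlt M (rq r)) (sim_step M))
      (St r (ih (?f t)) (sim_rows s m a b j) (2 * wh (?f t)) (?C (?f t)) (ch (?f t) * m) y)
      (St r' (ih (?f T)) (sim_rows s m a' b j) (2 * wh (?f T)) (?C (?f T)) (ch (?f T) * m) y) \<and>
      rf r' = rf r \<and> (ot (?f T) = [] \<or> ro r' = last (ot (?f T)))"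
    if "t \<le> T" "\<And>p. p < s \<Longrightarrow> a (2 * p) = wt (?f t) ! p" "rq r = st (?f t)"
      "ot (?f t) = [] \<or> ro r = last (ot (?f t))" for t r a
    using that
  proof (induction "T - t" arbitrary: t r a)
    case 0
    then have t: "t = T" by simp
    have "\<not> test x (\<lambda>r i w b. \<not> hlt M (rq r))
        (St r (ih (?f t)) (sim_rows s m a b j) (2 * wh (?f t)) (?C (?f t)) (ch (?f t) * m) y)"
      using T(1) 0 t by simp
    from exec_WhileF[OF this] show ?case using 0 t by blast
  next
    case (Suc n)
    then have lt: "t < T" by simp
    have m0: "0 < m" using m by simp
    obtain r1 a1 where 1: "exec x (sim_step M)
      (St r (ih (?f t)) (sim_rows s m a b j) (2 * wh (?f t)) (?C (?f t)) (ch (?f t) * m) y)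
      (St r1 (ih (?f (Suc t))) (sim_rows s m a1 b j) (2 * wh (?f (Suc t))) (?C (?f (Suc t))) (ch (?f (Suc t)) * m) y)"
      "\<And>p. p < s \<Longrightarrow> a1 (2 * p) = wt (?f (Suc t)) ! p" "rq r1 = st (?f (Suc t))" "rf r1 = rf r"
      "ot (?f (Suc t)) = [] \<or> ro r1 = last (ot (?f (Suc t)))"
      using exec_sim_step[OF ok T(2)[OF lt] m0 m(2) j C Suc.prems(2-4), of b y] by auto
    have t: "test x (\<lambda>r i w b. \<not> hlt M (rq r))
        (St r (ih (?f t)) (sim_rows s m a b j) (2 * wh (?f t)) (?C (?f t)) (ch (?f t) * m) y)"
      using T(2)[OF lt] Suc.prems by simp
    have "n = T - Suc t" "Suc t \<le> T" using Suc.hyps(2) by auto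
    from Suc.hyps(1)[OF this 1(2,3,5)] exec_WhileT[OF t 1(1)] 1(4)
    show ?case by metis
  qed
  let ?r = "r\<lparr>rq := 0\<rparr>"
  have e1: "exec x input_rewind (St r i (sim_rows s m a b j) 0 (put_col m j \<tau> C) 0 y)
      (St r 0 (sim_rows s m a b j) 0 (put_col m j \<tau> C) 0 y)"
    using s i by (intro exec_input_rewind) (auto simp: sim_rows_def)
  have e2: "exec x clear_A (St r 0 (sim_rows s m a b j) 0 (put_col m j \<tau> C) 0 y)
      (St r 0 (sim_rows s m never b j) 0 (put_col m j \<tau> C) 0 y)"
    unfolding sim_rows_def using s by (intro exec_clear_A) auto
  have e3: "exec x (Prim (\<lambda>r i w b. (r\<lparr>rq := 0\<rparr>, w, b, Stay, Stay, Stay, None)))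
      (St r 0 (sim_rows s m never b j) 0 (put_col m j \<tau> C) 0 y)
      (St ?r 0 (sim_rows s m never b j) 0 (put_col m j \<tau> C) 0 y)"
    by (intro exec_Prim) simp
  obtain r1 a1 where e4: "exec x (While (\<lambda>r i w b. \<not> hlt M (rq r)) (sim_step M))
      (St ?r 0 (sim_rows s m never b j) 0 (put_col m j \<tau> C) 0 y)
      (St r1 (ih (?f T)) (sim_rows s m a1 b j) (2 * wh (?f T)) (?C (?f T)) (ch (?f T) * m) y)"
    and r1: "rf r1 = rf r" "ot (?f T) = [] \<or> ro r1 = last (ot (?f T))"
    using loop[of 0 never ?r] by (auto simp: init_def never_def)
  have f: "wh (?f T) < s" "ih (?f T) \<le> length x + 1" "length (ct (?f T)) = c" "ch (?f T) < c"
    using ok[of T] by (auto simp: conf_ok_def)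
  have k: "Suc (ch (?f T) * m) < length (?C (?f T))"
    using cell_less[OF f(4), of 1 m] m C by simp
  have e5: "exec x rewind (St r1 (ih (?f T)) (sim_rows s m a1 b j) (2 * wh (?f T)) (?C (?f T)) (ch (?f T) * m) y)
      (St r1 (ih (?f T)) (sim_rows s m a1 b j) 0 (?C (?f T)) (ch (?f T) * m) y)"
    unfolding sim_rows_def using f k by (intro exec_rewind_mk) auto
  have W: "0 < length (sim_rows s m a1 b j)" using s by (simp add: sim_rows_def)
  obtain u v w where e6: "exec x (to_end Lft skip) (St r1 (ih (?f T)) (sim_rows s m a1 b j) 0 (?C (?f T)) (ch (?f T) * m) y)
      (St (r1\<lparr>ru := u, rv := v, rr := w\<rparr>) (ih (?f T)) (sim_rows s m a1 b j) 0 (?C (?f T)) 0 y)"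
    using exec_to_end_Lft[OF f(2) W k] by blast
  have "exec x (run M) (St r i (sim_rows s m a b j) 0 (put_col m j \<tau> C) 0 y)
     (St (r1\<lparr>ru := u, rv := v, rr := w\<rparr>) (ih (?f T)) (sim_rows s m a1 b j) 0 (?C (?f T)) 0 y)"
    unfolding run_def
    by (rule exec_Seq[OF e1 exec_Seq[OF e2 exec_Seq[OF e3 exec_Seq[OF e4 exec_Seq[OF e5 e6]]]]])
  then show ?thesis using f(2) r1 out unfolding fin
    by (intro exI[of _ "r1\<lparr>ru := u, rv := v, rr := w\<rparr>"] exI[of _ "ih (?f T)"] exI[of _ a1]) auto
qed

section \<open>Setting up the work tape\<close>

definition setup_rows :: "regs prog" where
  "setup_rows = init_rows ;; move Stay Stay Rgt ;; increment ;; increment ;; to_end Rgt increment ;;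
     move Stay Stay Lft ;; to_end Lft skip ;; edit_row (\<lambda>w. w\<lparr>tJ := True\<rparr>) Stay"

lemma exec_setup_rows:
  assumes i: "i \<le> length x + 1" and s: "0 < s" and c: "0 < c" and m: "2 \<le> m" "m < 2 * s"
    and T: "c * m < 2 ^ m" "2 ^ (m - 1) \<le> c * m" and C: "length C = c * m"
  shows "\<exists>u v w b. exec x setup_rows (St r i (replicate (2 * s) blank_row) 0 C 0 y)
     (St (r\<lparr>ru := u, rv := v, rr := w\<rparr>) i (sim_rows s m (below (2 * s)) b 0) 0 C 0 y)"
proof -
  let ?n = "2 * s" and ?T = "c * m"
  let ?W = "counter_rows ?n"
  have T2: "2 \<le> ?T" using c m mult_le_mono[of 1 c 2 m] by simp
  have c2: "Suc (Suc (?T - 2)) = ?T" using T2 by linarith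
  have p2: "(2::nat) ^ m \<le> 2 ^ ?n" using m by (intro power_increasing) auto
  have le: "v < ?T \<Longrightarrow> Suc v < 2 ^ ?n" for v
    using T(1) p2 by linarith
  have W: "0 < length (?W t)" for t using s by (simp add: counter_rows_def)
  have e1: "exec x init_rows (St r i (replicate ?n blank_row) 0 C 0 y) (St r i (?W 0) 0 C 0 y)"
    using exec_init_rows[OF i, of 0 C ?n r y] s unfolding counter_rows_0 by simp
  have e2: "exec x (move Stay Stay Rgt) (St r i (?W 0) 0 C 0 y) (St r i (?W 0) 0 C (Suc 0) y)"
    using exec_move[of x Stay Stay Rgt r i "?W 0" 0 C 0 y] i T2 C by (simp add: min.absorb1)
  have inc: "exec x increment (St r i (?W v) 0 C k y) (St r i (?W (Suc v)) 0 C k y)"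
    if "v < ?T" "k \<le> length C - 1" for v k r
    by (rule exec_increment[OF i that(2) le[OF that(1)]])
  have e3: "exec x increment (St r i (?W 0) 0 C (Suc 0) y) (St r i (?W (Suc 0)) 0 C (Suc 0) y)"
    using T2 C c m by (intro inc) auto
  have e4: "exec x increment (St r i (?W (Suc 0)) 0 C (Suc 0) y) (St r i (?W (Suc (Suc 0))) 0 C (Suc 0) y)"
    using T2 C c m by (intro inc) auto
  obtain u v w where e5: "exec x (to_end Rgt increment) (St r i (?W (Suc (Suc 0))) 0 C (Suc 0) y)
      (St (r\<lparr>ru := u, rv := v, rr := w\<rparr>) i (?W ?T) 0 C (?T - 1) y)" (is "exec x _ _ (St ?r _ _ _ _ _ _)")
    using exec_to_end_Rgt[of i x ?W ?T C increment y 0 "Suc (Suc 0)" r, OF i W inc] T2 C c2 by auto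
  have e6: "exec x (move Stay Stay Lft) (St ?r i (?W ?T) 0 C (?T - 1) y) (St ?r i (?W ?T) 0 C (?T - 2) y)"
    using exec_move[of x Stay Stay Lft ?r i "?W ?T" 0 C "?T - 1" y] i by (simp add: numeral_2_eq_2)
  have t2: "Suc (?T - 2) < length C" using T2 C by simp
  obtain u' v' w' where e7: "exec x (to_end Lft skip) (St ?r i (?W ?T) 0 C (?T - 2) y)
      (St (?r\<lparr>ru := u', rv := v', rr := w'\<rparr>) i (?W ?T) 0 C 0 y)" (is "exec x _ _ (St ?r' _ _ _ _ _ _)")
    using exec_to_end_Lft[OF i W t2] by blast
  have U: "2 ^ i \<le> ?T \<longleftrightarrow> i < m" for i
  proof
    assume "2 ^ i \<le> ?T"
    then have "(2::nat) ^ i < 2 ^ m" using T(1) by linarith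
    then show "i < m" by simp
  next
    assume "i < m"
    then have "(2::nat) ^ i \<le> 2 ^ (m - 1)" by (intro power_increasing) auto
    then show "2 ^ i \<le> ?T" using T(2) by linarith
  qed
  have Ub: "(\<lambda>i. 2 ^ i \<le> ?T) = below m" by (simp add: U below_def fun_eq_iff)
  have "never(0 := True) = only 0" by (auto simp: never_def only_def fun_eq_iff)
  then have rows: "(?W ?T)[0 := (?W ?T ! 0)\<lparr>tJ := True\<rparr>] = sim_rows s m (below ?n) (\<lambda>i. bin ?n ?T ! i) 0"
    using s unfolding counter_rows_def sim_rows_def Ub by simp
  have e8: "exec x (edit_row (\<lambda>w. w\<lparr>tJ := True\<rparr>) Stay) (St ?r' i (?W ?T) 0 C 0 y)
      (St ?r' i (sim_rows s m (below ?n) (\<lambda>i. bin ?n ?T ! i) 0) 0 C 0 y)"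
    using exec_edit_row[OF i, of 0 C "\<lambda>w. w\<lparr>tJ := True\<rparr>" Stay ?r' "?W ?T" 0 y] unfolding rows by simp
  have "exec x setup_rows (St r i (replicate ?n blank_row) 0 C 0 y)
      (St ?r' i (sim_rows s m (below ?n) (\<lambda>i. bin ?n ?T ! i) 0) 0 C 0 y)"
    unfolding setup_rows_def
    by (rule exec_Seq[OF e1 exec_Seq[OF e2 exec_Seq[OF e3 exec_Seq[OF e4 exec_Seq[OF e5 exec_Seq[OF e6 exec_Seq[OF e7 e8]]]]]]])
  then show ?thesis by auto
qed

section \<open>Moving on to the next catalytic string\<close>

definition clear_msb :: "regs prog" where
  "clear_msb = Prim (\<lambda>r i w b. (r\<lparr>rf := True\<rparr>, w, b, Stay, Stay, Rgt, None)) ;;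
     to_end Rgt skip ;; stride_pred Lft ;; jump Rgt ;; put (\<lambda>_. False) Stay ;; jump Lft ;; to_end Lft skip"

definition inc_col :: "regs prog" where
  "inc_col = jump Rgt ;;
     While (\<lambda>r i w b. b) (put (\<lambda>_. False) Stay ;; jump Lft ;; row_right ;; jump Rgt) ;;
     put (\<lambda>_. True) Stay ;; jump Lft ;; to_end Lft skip"

definition advance :: "regs prog" where
  "advance = scan (\<lambda>w. \<not> tJ w) Stay ;; edit_row (\<lambda>w. w\<lparr>tJ := False\<rparr>) Rgt ;;
     Cond (\<lambda>r i w b. tU w) (edit_row (\<lambda>w. w\<lparr>tJ := True\<rparr>) Stay ;; rewind)
       (move Stay Lft Stay ;; edit_row (\<lambda>w. w\<lparr>tJ := True\<rparr>) Stay ;; rewind ;;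
        Cond (\<lambda>r i w b. rf r) inc_col clear_msb)"

locale layout =
  fixes x :: "bool list" and s c m :: nat
  assumes s_pos: "0 < s" and c_pos: "0 < c" and m_ge: "2 \<le> m" and m_less: "m < 2 * s"
begin

lemma m_pos: "0 < m"
  using m_ge by simp

lemma length_sim_rows [simp]: "length (sim_rows s m a b j) = 2 * s"
  by (simp add: sim_rows_def)

lemma exec_advance_start:
  assumes "i \<le> length x + 1" "j < m"
  shows "exec x (scan (\<lambda>w. \<not> tJ w) Stay ;; edit_row (\<lambda>w. w\<lparr>tJ := False\<rparr>) Rgt)
    (St r i (sim_rows s m a b j) 0 C 0 y)
    (St r i (mk (2 * s) a (only 0) (only (2 * s - 1)) (below m) b never never) (Suc j) C 0 y)"
proof -
  have up: "(only j)(j := False) = never" by (auto simp: only_def never_def fun_eq_iff)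
  have 1: "exec x (scan (\<lambda>w. \<not> tJ w) Stay) (St r i (sim_rows s m a b j) 0 C 0 y) (St r i (sim_rows s m a b j) j C 0 y)"
    using exec_scan[OF assms(1), of 0 C 0 j "\<lambda>w. \<not> tJ w" "sim_rows s m a b j" Stay r y] assms(2) m_less
      funpow_mv_Stay[of 0 "length C - 1" j]
    by (simp add: only_def sim_rows_def)
  have 2: "exec x (edit_row (\<lambda>w. w\<lparr>tJ := False\<rparr>) Rgt) (St r i (sim_rows s m a b j) j C 0 y)
    (St r i (mk (2 * s) a (only 0) (only (2 * s - 1)) (below m) b never never) (Suc j) C 0 y)"
    using exec_edit_row[OF assms(1), of 0 C "\<lambda>w. w\<lparr>tJ := False\<rparr>" Rgt r "sim_rows s m a b j" j y] assms(2) m_less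
    by (simp add: sim_rows_def up min.absorb1)
  show ?thesis by (rule exec_Seq[OF 1 2])
qed

lemma exec_Seq_assoc: "exec x (p ;; q) S S' \<Longrightarrow> exec x t S' S'' \<Longrightarrow> exec x (p ;; q ;; t) S S''"
  by (elim exec_SeqE) (blast intro: exec_Seq)

lemma exec_mark_column:
  assumes "i \<le> length x + 1" "j < m"
  shows "exec x (edit_row (\<lambda>w. w\<lparr>tJ := True\<rparr>) Stay)
      (St r i (mk (2 * s) a (only 0) (only (2 * s - 1)) (below m) b never never) j C 0 y)
      (St r i (sim_rows s m a b j) j C 0 y)"
    and "exec x rewind (St r i (sim_rows s m a b j) j C 0 y) (St r i (sim_rows s m a b j) 0 C 0 y)"
proof -
  have "never(j := True) = only j" by (auto simp: only_def never_def fun_eq_iff)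
  then show "exec x (edit_row (\<lambda>w. w\<lparr>tJ := True\<rparr>) Stay)
      (St r i (mk (2 * s) a (only 0) (only (2 * s - 1)) (below m) b never never) j C 0 y)
      (St r i (sim_rows s m a b j) j C 0 y)"
    using exec_edit_row[OF assms(1), of 0 C "\<lambda>w. w\<lparr>tJ := True\<rparr>" Stay r
        "mk (2 * s) a (only 0) (only (2 * s - 1)) (below m) b never never" j y] assms(2) m_less
    by (simp add: sim_rows_def min.absorb1)
  show "exec x rewind (St r i (sim_rows s m a b j) j C 0 y) (St r i (sim_rows s m a b j) 0 C 0 y)"
    unfolding sim_rows_def using assms m_less by (intro exec_rewind_mk) auto
qed

lemma exec_advance_next:
  assumes "i \<le> length x + 1" "Suc j < m"
  shows "exec x advance (St r i (sim_rows s m a b j) 0 C 0 y) (St r i (sim_rows s m a b (Suc j)) 0 C 0 y)"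
proof -
  let ?S = "St r i (mk (2 * s) a (only 0) (only (2 * s - 1)) (below m) b never never) (Suc j) C 0 y"
  have t: "test x (\<lambda>r i w b. tU w) ?S" using assms(2) m_less by (simp add: below_def)
  have j: "j < m" using assms(2) by simp
  show ?thesis unfolding advance_def
    by (rule exec_Seq_assoc[OF exec_advance_start[OF assms(1) j] exec_IfT[OF t
      exec_Seq[OF exec_mark_column[OF assms(1,2)]]]])
qed

lemma exec_advance_last:
  assumes "i \<le> length x + 1" "Suc j = m"
    and "exec x (Cond (\<lambda>r i w b. rf r) inc_col clear_msb) (St r i (sim_rows s m a b j) 0 C 0 y) S'"
  shows "exec x advance (St r i (sim_rows s m a b j) 0 C 0 y) S'"
proof -
  let ?W = "mk (2 * s) a (only 0) (only (2 * s - 1)) (below m) b never never"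
  have t: "\<not> test x (\<lambda>r i w b. tU w) (St r i ?W (Suc j) C 0 y)" using assms(2) m_less by (simp add: below_def)
  have j: "j < m" using assms(2) by simp
  have l: "exec x (move Stay Lft Stay) (St r i ?W (Suc j) C 0 y) (St r i ?W j C 0 y)"
    using exec_move[of x Stay Lft Stay r i ?W "Suc j" C 0 y] assms(1) by simp
  show ?thesis unfolding advance_def
    by (rule exec_Seq_assoc[OF exec_advance_start[OF assms(1) j] exec_IfF[OF t
      exec_Seq[OF l exec_Seq[OF exec_mark_column(1)[OF assms(1) j] exec_Seq[OF exec_mark_column(2)[OF assms(1) j] assms(3)]]]]])
qed

lemma exec_clear_msb:
  assumes i: "i \<le> length x + 1" and j: "j < m" and C: "length C = c * m" and \<tau>: "length \<tau> = c"
  shows "\<exists>r'. exec x clear_msb (St r i (sim_rows s m a b j) 0 (put_col m j \<tau> C) 0 y)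
    (St r' i (sim_rows s m a b j) 0 (put_col m j (\<tau>[c - 1 := False]) C) 0 y) \<and> rf r'"
proof -
  let ?W = "sim_rows s m a b j" and ?D = "put_col m j \<tau> C" and ?D' = "put_col m j (\<tau>[c - 1 := False]) C"
  let ?T = "c * m" and ?k = "(c - 1) * m"
  have D: "length ?D = ?T" "length ?D' = ?T" using C by simp_all
  have T2: "2 \<le> ?T" using c_pos m_ge mult_le_mono[of 1 c 2 m] by simp
  have W: "0 < length ?W" using s_pos by simp
  have kT: "?k + j < ?T" "?T - 1 - (m - 1) = ?k" "Suc ?k < ?T"
    using cell_less[of "c - 1" c j m] cell_less[of "c - 1" c 1 m] c_pos j m_ge by (auto simp: diff_mult_distrib)
  let ?r = "r\<lparr>rf := True\<rparr>"
  have e1: "exec x (Prim (\<lambda>r i w b. (r\<lparr>rf := True\<rparr>, w, b, Stay, Stay, Rgt, None)))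
      (St r i ?W 0 ?D 0 y) (St ?r i ?W 0 ?D (Suc 0) y)"
    using i T2 C by (intro exec_Prim) (simp add: min.absorb1)
  have sk: "exec x skip (St r i ?W 0 ?D k y) (St r i ?W 0 ?D k y)" if "k \<le> length ?D - 1" for r k
    by (rule exec_skip[OF i that W])
  obtain u v w where e2: "exec x (to_end Rgt skip) (St ?r i ?W 0 ?D (Suc 0) y)
      (St (?r\<lparr>ru := u, rv := v, rr := w\<rparr>) i ?W 0 ?D (?T - 1) y)" (is "exec x _ _ (St ?r' _ _ _ _ _ _)")
    using exec_to_end_Rgt[of i x "\<lambda>_. ?W" "length ?D" ?D skip y 0 0 ?r, OF i W sk] T2 C by auto
  have e3: "exec x (stride_pred Lft) (St ?r' i ?W 0 ?D (?T - 1) y) (St ?r' i ?W 0 ?D ?k y)"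
    unfolding sim_rows_def
    using exec_stride_pred[OF i _ m_less m_pos, of "?T - 1" ?D Lft ?r' a "only (2 * s - 1)" b "only j" never y] D m_pos
      diff_mult_distrib[of c 1 m]
    by (simp add: funpow_mv_Lft del: mv.simps)
  have e4: "exec x (jump Rgt) (St ?r' i ?W 0 ?D ?k y) (St ?r' i ?W 0 ?D (?k + j) y)"
    unfolding sim_rows_def using D kT j m_less by (intro exec_jump_Rgt i) auto
  have e5: "exec x (put (\<lambda>_. False) Stay) (St ?r' i ?W 0 ?D (?k + j) y) (St ?r' i ?W 0 ?D' (?k + j) y)"
    using exec_put[OF i W, of "\<lambda>_. False" Stay ?r' ?D "?k + j" y] D kT put_col_update[OF C _ j \<tau>, of "c - 1" False] c_pos
    by (simp add: min.absorb1)
  have e6: "exec x (jump Lft) (St ?r' i ?W 0 ?D' (?k + j) y) (St ?r' i ?W 0 ?D' ?k y)"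
    unfolding sim_rows_def using exec_jump_Lft[OF i, of "?k + j" ?D' j "2 * s"] D kT j m_less by simp
  obtain u' v' w' where e7: "exec x (to_end Lft skip) (St ?r' i ?W 0 ?D' ?k y)
      (St (?r'\<lparr>ru := u', rv := v', rr := w'\<rparr>) i ?W 0 ?D' 0 y)"
    using exec_to_end_Lft[OF i W, of ?k ?D'] kT(3)[folded D(2)] by blast
  show ?thesis unfolding clear_msb_def
    using exec_Seq[OF e1 exec_Seq[OF e2 exec_Seq[OF e3 exec_Seq[OF e4 exec_Seq[OF e5 exec_Seq[OF e6 e7]]]]]]
    by (intro exI[of _ "?r'\<lparr>ru := u', rv := v', rr := w'\<rparr>"]) simp
qed

lemma exec_inc_col:
  assumes i: "i \<le> length x + 1" and j: "j < m" and C: "length C = c * m"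
    and \<tau>: "length \<tau> = c" "\<tau> = replicate p True @ False # rest"
  shows "\<exists>r'. exec x inc_col (St r i (sim_rows s m a b j) 0 (put_col m j \<tau> C) 0 y)
    (St r' i (sim_rows s m a b j) 0 (put_col m j (replicate p False @ True # rest) C) 0 y) \<and> rf r' = rf r"
proof -
  let ?W = "sim_rows s m a b j"
  define v where "v t = replicate t False @ drop t \<tau>" for t
  let ?D = "\<lambda>t. put_col m j (v t) C" and ?D' = "put_col m j (replicate p False @ True # rest) C"
  have W: "0 < length ?W" using s_pos by simp
  have pc: "p < c" using \<tau> by auto
  have D: "length (?D t) = c * m" for t using C by simp
  have lv: "length (v t) = c" if "t \<le> c" for t using that \<tau>(1) by (simp add: v_def)
  have vt: "v t ! t" if "t < p" for t using that by (simp add: v_def nth_append \<tau>(2))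
  have vp: "\<not> v p ! p" by (simp add: v_def nth_append \<tau>(2))
  have vs: "(v t)[t := False] = v (Suc t)" if "t < p" for t
  proof -
    have "drop t \<tau> = True # drop (Suc t) \<tau>"
      using that \<tau> pc by (subst Cons_nth_drop_Suc[symmetric]) (auto simp: nth_append)
    then show ?thesis by (simp add: v_def list_update_append replicate_append_same[symmetric])
  qed
  have vT: "(v p)[p := True] = replicate p False @ True # rest"
    by (simp add: v_def \<tau>(2) list_update_append)
  have bit: "rd (?D t) (t * m + j) = v t ! t" if "t < c" for t
    using nth_put_col[OF C that j] cell_less[OF that j] C by (simp add: rd_def)
  let ?w = "While (\<lambda>r i w b. b) (put (\<lambda>_. False) Stay ;; jump Lft ;; row_right ;; jump Rgt)"
  have jL: "exec x (jump Lft) (St r i ?W 0 E (t * m + j) y) (St r i ?W 0 E (t * m) y)"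
    if "t < c" "length E = c * m" for t E r
    unfolding sim_rows_def using exec_jump_Lft[OF i, of "t * m + j" E j "2 * s"] that cell_less[OF that(1) j] j m_less by simp
  have jR: "exec x (jump Rgt) (St r i ?W 0 E (t * m) y) (St r i ?W 0 E (t * m + j) y)"
    if "t < c" "length E = c * m" for t E r
    unfolding sim_rows_def using that cell_less[OF that(1) j] j m_less by (intro exec_jump_Rgt i) auto
  have pt: "exec x (put (\<lambda>_. z) Stay) (St r i ?W 0 (?D t) (t * m + j) y)
      (St r i ?W 0 (put_col m j ((v t)[t := z]) C) (t * m + j) y)" if "t < c" for t r z
    using exec_put[OF i W, of "\<lambda>_. z" Stay r "?D t" "t * m + j" y] cell_less[OF that j] C
      put_col_update[OF C that j, of "v t" z] lv[of t] that
    by (simp add: min.absorb1)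
  have loop: "exec x ?w (St r i ?W 0 (?D t) (t * m + j) y) (St r i ?W 0 (?D p) (p * m + j) y)" if "t \<le> p" for t
    using that
  proof (induction "p - t" arbitrary: t)
    case 0
    then have t: "t = p" by simp
    have "\<not> test x (\<lambda>r i w b. b) (St r i ?W 0 (?D p) (p * m + j) y)" using bit[OF pc] vp by simp
    from exec_WhileF[OF this] show ?case unfolding t .
  next
    case (Suc n)
    then have t: "t < p" "t < c" "Suc t < c" using pc by auto
    have tst: "test x (\<lambda>r i w b. b) (St r i ?W 0 (?D t) (t * m + j) y)" using bit[OF t(2)] vt[OF t(1)] by simp
    have 3: "exec x row_right (St r i ?W 0 (?D (Suc t)) (t * m) y) (St r i ?W 0 (?D (Suc t)) (Suc t * m) y)"
      unfolding sim_rows_def using exec_row_right[OF i D t(2) m_pos m_less] t(3) by (simp add: min.absorb1)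
    have "exec x (put (\<lambda>_. False) Stay ;; jump Lft ;; row_right ;; jump Rgt)
       (St r i ?W 0 (?D t) (t * m + j) y) (St r i ?W 0 (?D (Suc t)) (Suc t * m + j) y)"
      by (rule exec_Seq[OF pt[OF t(2), of False r, unfolded vs[OF t(1)]] exec_Seq[OF jL[OF t(2) D] exec_Seq[OF 3 jR[OF t(3) D]]]])
    moreover have "exec x ?w (St r i ?W 0 (?D (Suc t)) (Suc t * m + j) y) (St r i ?W 0 (?D p) (p * m + j) y)"
      using Suc t by (intro Suc.hyps(1)) auto
    ultimately show ?case by (rule exec_WhileT[OF tst])
  qed
  have D': "length ?D' = c * m" using C by simp
  have kT: "Suc (p * m) < length ?D'" using cell_less[OF pc, of 1 m] m_ge C by simp
  obtain u w z where e: "exec x (to_end Lft skip) (St r i ?W 0 ?D' (p * m) y)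
      (St (r\<lparr>ru := u, rv := w, rr := z\<rparr>) i ?W 0 ?D' 0 y)"
    using exec_to_end_Lft[OF i W kT] by blast
  have v0: "?D 0 = put_col m j \<tau> C" by (simp add: v_def)
  have st: "exec x (jump Rgt) (St r i ?W 0 (?D 0) 0 y) (St r i ?W 0 (?D 0) (0 * m + j) y)"
    using jR[OF c_pos D, of r 0] by simp
  have "exec x inc_col (St r i ?W 0 (?D 0) 0 y) (St (r\<lparr>ru := u, rv := w, rr := z\<rparr>) i ?W 0 ?D' 0 y)"
    unfolding inc_col_def
    by (rule exec_Seq[OF st exec_Seq[OF loop[OF le0] exec_Seq[OF pt[OF pc, of True r, unfolded vT] exec_Seq[OF jL[OF pc D'] e]]]])
  then show ?thesis unfolding v0
    by (intro exI[of _ "r\<lparr>ru := u, rv := w, rr := z\<rparr>"]) simp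
qed

end

section \<open>Searching for a good catalytic string\<close>

fun val :: "bool list \<Rightarrow> nat" where
  "val [] = 0"
| "val (b # bs) = of_bool b + 2 * val bs"

lemma val_less: "val bs < 2 ^ length bs"
  by (induction bs) auto

lemma val_inject: "length bs = length bs' \<Longrightarrow> val bs = val bs' \<Longrightarrow> bs = bs'"
proof (induction bs bs' rule: list_induct2)
  case (Cons b bs b' bs')
  then have "of_bool b + 2 * val bs = of_bool b' + 2 * val bs'" by simp
  then have "b = b'" "val bs = val bs'" by (cases b; cases b'; simp; presburger)+
  then show ?case using Cons by simp
qed simp

lemma val_Suc:
  "Suc (val bs) < 2 ^ length bs \<Longrightarrow> \<exists>p rest. bs = replicate p True @ False # rest \<and>
     val (replicate p False @ True # rest) = Suc (val bs)"
proof (induction bs)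
  case (Cons b bs)
  show ?case
  proof (cases b)
    case True
    then have "Suc (val bs) < 2 ^ length bs" using Cons.prems by simp
    then obtain p rest where "bs = replicate p True @ False # rest"
      "val (replicate p False @ True # rest) = Suc (val bs)" using Cons.IH by blast
    then show ?thesis using True by (intro exI[of _ "Suc p"] exI[of _ rest]) simp
  qed (auto intro!: exI[of _ 0])
qed simp

lemma val_clear_last:
  assumes "length bs = Suc n"
  shows "val (bs[n := False]) < 2 ^ n"
proof -
  have append: "val (xs @ [False]) = val xs" for xs by (induction xs) auto
  obtain xs b where bs: "bs = xs @ [b]" using assms by (cases bs rule: rev_cases) auto
  then have "bs[n := False] = xs @ [False]" using assms by (simp add: list_update_append)
  then show ?thesis using val_less[of xs] bs assms by (simp add: append)
qed

definition search :: "mach \<Rightarrow> regs prog" where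
  "search M = While (\<lambda>r i w b. ro r = Bot) (advance ;; run M)"

definition main :: "mach \<Rightarrow> regs prog" where
  "main M = setup_rows ;; run M ;; search M ;;
     Prim (\<lambda>r i w b. (r, w, b, Stay, Stay, Stay, Some (ro r)))"

locale zero_error = layout +
  fixes M :: mach and ans :: bool
  assumes zero_error: "length \<tau> = c \<Longrightarrow> halts M x s \<tau> \<and> ct (final M x s \<tau>) = \<tau> \<and>
      ot (final M x s \<tau>) \<in> {[dec ans], [Bot]}"
    and half_good: "2 ^ c \<le> 2 * card {\<tau>. length \<tau> = c \<and> ot (final M x s \<tau>) = [dec ans]}"
begin

definition good :: "bool list \<Rightarrow> bool" where
  "good \<tau> \<longleftrightarrow> ot (final M x s \<tau>) = [dec ans]"

lemma dec_neq_Bot [simp]: "dec b \<noteq> Bot"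
  by (simp add: dec_def)

lemma exec_run_col:
  assumes "length \<tau> = c" "j < m" "length C = c * m" "i \<le> length x + 1"
  shows "\<exists>r' i' a'. exec x (run M) (St r i (sim_rows s m a b j) 0 (put_col m j \<tau> C) 0 y)
      (St r' i' (sim_rows s m a' b j) 0 (put_col m j \<tau> C) 0 y) \<and>
    i' \<le> length x + 1 \<and> rf r' = rf r \<and> ro r' = (if good \<tau> then dec ans else Bot)"
proof -
  note z = zero_error[OF assms(1)]
  have ne: "ot (final M x s \<tau>) \<noteq> []" using z by auto
  show ?thesis
    using exec_run[of M x s \<tau>, OF _ assms(1) s_pos c_pos m_ge m_less assms(2,3,4) ne, of r a b y] z
    by (fastforce simp: good_def)
qed

text \<open>The clamped counter never returns below half of its range, but starting with a cleared most
  significant bit it passes through more than half of all strings, hence through a good one.\<close>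

lemma ex_good_above:
  assumes "val \<tau> < 2 ^ (c - 1)"
  shows "\<exists>\<tau>'. length \<tau>' = c \<and> good \<tau>' \<and> val \<tau> \<le> val \<tau>'"
proof (rule ccontr)
  assume "\<not> ?thesis"
  then have sub: "val ` {\<tau>. length \<tau> = c \<and> good \<tau>} \<subseteq> {..<val \<tau>}" by force
  have "card {\<tau>. length \<tau> = c \<and> good \<tau>} = card (val ` {\<tau>. length \<tau> = c \<and> good \<tau>})"
    by (rule card_image[symmetric]) (auto intro!: inj_onI val_inject)
  also have "\<dots> \<le> val \<tau>" using card_mono[OF _ sub] by simp
  finally have "2 * card {\<tau>. length \<tau> = c \<and> good \<tau>} < 2 * 2 ^ (c - 1)" using assms by simp
  also have "2 * 2 ^ (c - 1) = (2::nat) ^ c" using c_pos by (metis Suc_pred' power_Suc)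
  finally show False using half_good by (simp add: good_def)
qed

lemma exec_search_counting:
  assumes j: "Suc j = m" and C: "length C = c * m"
    and \<tau>': "length \<tau>' = c" "good \<tau>'"
  shows "length \<tau> = c \<Longrightarrow> val \<tau> \<le> val \<tau>' \<Longrightarrow> i \<le> length x + 1 \<Longrightarrow> rf r \<Longrightarrow>
    ro r = (if good \<tau> then dec ans else Bot) \<Longrightarrow>
    \<exists>\<tau>'' r' i' a'. exec x (search M) (St r i (sim_rows s m a b j) 0 (put_col m j \<tau> C) 0 y)
      (St r' i' (sim_rows s m a' b j) 0 (put_col m j \<tau>'' C) 0 y) \<and> ro r' = dec ans"
proof (induction "val \<tau>' - val \<tau>" arbitrary: \<tau> i r a rule: less_induct)
  case less
  let ?S = "St r i (sim_rows s m a b j) 0 (put_col m j \<tau> C) 0 y"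
  show ?case
  proof (cases "good \<tau>")
    case True
    then have "\<not> test x (\<lambda>r i w b. ro r = Bot) ?S" using less.prems by simp
    from exec_WhileF[OF this] show ?thesis using True less.prems unfolding search_def by fastforce
  next
    case False
    have jm: "j < m" using j by simp
    have "val \<tau> \<noteq> val \<tau>'" using val_inject[of \<tau> \<tau>'] less.prems(1) \<tau>' False by auto
    then have lt: "val \<tau> < val \<tau>'" using less.prems(2) by simp
    then have "Suc (val \<tau>) < 2 ^ length \<tau>" using val_less[of \<tau>'] \<tau>'(1) less.prems(1) by simp
    then obtain p rest where p: "\<tau> = replicate p True @ False # rest"
      "val (replicate p False @ True # rest) = Suc (val \<tau>)" using val_Suc by blast
    define \<sigma> where "\<sigma> = replicate p False @ True # rest"
    have \<sigma>: "length \<sigma> = c" "val \<sigma> = Suc (val \<tau>)" using p less.prems(1) by (auto simp: \<sigma>_def)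
    obtain r1 where 1: "exec x inc_col ?S (St r1 i (sim_rows s m a b j) 0 (put_col m j \<sigma> C) 0 y)" "rf r1 = rf r"
      using exec_inc_col[OF less.prems(3) jm C less.prems(1) p(1)] unfolding \<sigma>_def by blast
    have "test x (\<lambda>r i w b. rf r) ?S" using less.prems(4) by simp
    from exec_advance_last[OF less.prems(3) j exec_IfT[OF this 1(1)]]
    have 2: "exec x advance ?S (St r1 i (sim_rows s m a b j) 0 (put_col m j \<sigma> C) 0 y)" .
    obtain r2 i2 a2 where 3: "exec x (run M) (St r1 i (sim_rows s m a b j) 0 (put_col m j \<sigma> C) 0 y)
        (St r2 i2 (sim_rows s m a2 b j) 0 (put_col m j \<sigma> C) 0 y)"
      "i2 \<le> length x + 1" "rf r2 = rf r1" "ro r2 = (if good \<sigma> then dec ans else Bot)"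
      using exec_run_col[OF \<sigma>(1) jm C less.prems(3)] by blast
    have "\<exists>\<tau>'' r' i' a'. exec x (search M) (St r2 i2 (sim_rows s m a2 b j) 0 (put_col m j \<sigma> C) 0 y)
      (St r' i' (sim_rows s m a' b j) 0 (put_col m j \<tau>'' C) 0 y) \<and> ro r' = dec ans"
      using lt \<sigma> 3 1(2) less.prems by (intro less.hyps) auto
    then obtain \<tau>'' r' i' a' where 4: "exec x (search M) (St r2 i2 (sim_rows s m a2 b j) 0 (put_col m j \<sigma> C) 0 y)
      (St r' i' (sim_rows s m a' b j) 0 (put_col m j \<tau>'' C) 0 y)" "ro r' = dec ans" by blast
    have "test x (\<lambda>r i w b. ro r = Bot) ?S" using False less.prems by simp
    from exec_WhileT[OF this exec_Seq[OF 2 3(1)] 4(1)[unfolded search_def]] 4(2)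
    show ?thesis unfolding search_def by blast
  qed
qed

lemma exec_search:
  assumes C: "length C = c * m"
  shows "j < m \<Longrightarrow> i \<le> length x + 1 \<Longrightarrow> \<not> rf r \<Longrightarrow> (\<forall>l < j. \<not> good (col m c l C)) \<Longrightarrow>
    ro r = (if good (col m c j C) then dec ans else Bot) \<Longrightarrow>
    \<exists>r' i' W' C'. exec x (search M) (St r i (sim_rows s m a b j) 0 C 0 y) (St r' i' W' 0 C' 0 y) \<and>
      ro r' = dec ans \<and> (C' = C \<or> (\<forall>l < m. \<not> good (col m c l C)) \<and> (\<exists>\<tau>. C' = put_col m (m - 1) \<tau> C))"
proof (induction "m - j" arbitrary: j i r a rule: less_induct)
  case less
  let ?S = "St r i (sim_rows s m a b j) 0 C 0 y"
  show ?case
  proof (cases "good (col m c j C)")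
    case True
    then have "\<not> test x (\<lambda>r i w b. ro r = Bot) ?S" using less.prems by simp
    from exec_WhileF[OF this] show ?thesis using True less.prems unfolding search_def by fastforce
  next
    case False
    have t: "test x (\<lambda>r i w b. ro r = Bot) ?S" using False less.prems by simp
    have bad: "\<forall>l < Suc j. \<not> good (col m c l C)" using False less.prems(4) by (auto simp: less_Suc_eq)
    show ?thesis
    proof (cases "Suc j < m")
      case True
      have 1: "exec x advance ?S (St r i (sim_rows s m a b (Suc j)) 0 C 0 y)"
        by (rule exec_advance_next[OF less.prems(2) True])
      obtain r2 i2 a2 where 2: "exec x (run M) (St r i (sim_rows s m a b (Suc j)) 0 C 0 y)
          (St r2 i2 (sim_rows s m a2 b (Suc j)) 0 C 0 y)"
        "i2 \<le> length x + 1" "rf r2 = rf r" "ro r2 = (if good (col m c (Suc j) C) then dec ans else Bot)"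
        using exec_run_col[OF length_col[of m c "Suc j" C] True C less.prems(2), of r a b y, unfolded put_col_col[OF C]]
        by blast
      have "\<exists>r' i' W' C'. exec x (search M) (St r2 i2 (sim_rows s m a2 b (Suc j)) 0 C 0 y) (St r' i' W' 0 C' 0 y) \<and>
          ro r' = dec ans \<and> (C' = C \<or> (\<forall>l < m. \<not> good (col m c l C)) \<and> (\<exists>\<tau>. C' = put_col m (m - 1) \<tau> C))"
        using True 2 less.prems bad by (intro less.hyps) auto
      then show ?thesis
        using exec_WhileT[OF t exec_Seq[OF 1 2(1)]] unfolding search_def by blast
    next
      case last: False
      then have j: "Suc j = m" using less.prems(1) by simp
      let ?\<tau> = "(col m c j C)[c - 1 := False]"
      obtain r1 where 1: "exec x clear_msb ?S (St r1 i (sim_rows s m a b j) 0 (put_col m j ?\<tau> C) 0 y)" "rf r1"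
        using exec_clear_msb[OF less.prems(2,1) C length_col[of m c j C], of r a b y, unfolded put_col_col[OF C]] by blast
      have "\<not> test x (\<lambda>r i w b. rf r) ?S" using less.prems(3) by simp
      from exec_advance_last[OF less.prems(2) j exec_IfF[OF this 1(1)]]
      have 2: "exec x advance ?S (St r1 i (sim_rows s m a b j) 0 (put_col m j ?\<tau> C) 0 y)" .
      have l: "length ?\<tau> = c" by simp
      obtain r2 i2 a2 where 3: "exec x (run M) (St r1 i (sim_rows s m a b j) 0 (put_col m j ?\<tau> C) 0 y)
          (St r2 i2 (sim_rows s m a2 b j) 0 (put_col m j ?\<tau> C) 0 y)"
        "i2 \<le> length x + 1" "rf r2 = rf r1" "ro r2 = (if good ?\<tau> then dec ans else Bot)"
        using exec_run_col[OF l less.prems(1) C less.prems(2)] by blast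
      have "val ?\<tau> < 2 ^ (c - 1)" using val_clear_last[of "col m c j C" "c - 1"] c_pos by simp
      then obtain \<tau>' where "length \<tau>' = c" "good \<tau>'" "val ?\<tau> \<le> val \<tau>'" using ex_good_above by blast
      then obtain \<tau>'' r' i' a' where 4: "exec x (search M) (St r2 i2 (sim_rows s m a2 b j) 0 (put_col m j ?\<tau> C) 0 y)
        (St r' i' (sim_rows s m a' b j) 0 (put_col m j \<tau>'' C) 0 y)" "ro r' = dec ans"
        using exec_search_counting[OF j C _ _ l, of \<tau>' i2 r2 a2 b y] 3 1(2) by blast
      have "exec x (search M) ?S (St r' i' (sim_rows s m a' b j) 0 (put_col m j \<tau>'' C) 0 y)"
        using exec_WhileT[OF t exec_Seq[OF 2 3(1)] 4(1)[unfolded search_def]] unfolding search_def .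
      moreover have "j = m - 1" "\<forall>l < m. \<not> good (col m c l C)" using j bad by auto
      ultimately show ?thesis using 4(2) by blast
    qed
  qed
qed


lemma exec_main:
  assumes T: "c * m < 2 ^ m" "2 ^ (m - 1) \<le> c * m" and C: "length C = c * m"
    and i: "i \<le> length x + 1" and r: "\<not> rf r"
  shows "\<exists>r' i' W' h' C' k'. exec x (main M) (St r i (replicate (2 * s) blank_row) 0 C 0 [])
      (St r' i' W' h' C' k' [dec ans]) \<and>
    (C' = C \<or> (\<forall>l < m. \<not> good (col m c l C)) \<and> (\<exists>\<tau>. C' = put_col m (m - 1) \<tau> C))"
proof -
  obtain u v w b where 1: "exec x setup_rows (St r i (replicate (2 * s) blank_row) 0 C 0 [])
     (St (r\<lparr>ru := u, rv := v, rr := w\<rparr>) i (sim_rows s m (below (2 * s)) b 0) 0 C 0 [])" (is "exec x _ _ (St ?r _ _ _ _ _ _)")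
    using exec_setup_rows[OF i s_pos c_pos m_ge m_less T C] by blast
  obtain r2 i2 a2 where 2: "exec x (run M) (St ?r i (sim_rows s m (below (2 * s)) b 0) 0 C 0 [])
      (St r2 i2 (sim_rows s m a2 b 0) 0 C 0 [])"
    "i2 \<le> length x + 1" "rf r2 = rf ?r" "ro r2 = (if good (col m c 0 C) then dec ans else Bot)"
    using exec_run_col[OF length_col[of m c 0 C] m_pos C i, of ?r "below (2 * s)" b "[]", unfolded put_col_col[OF C]]
    by blast
  have rf2: "\<not> rf r2" using 2(3) r by simp
  obtain r' i' W' C' where 3: "exec x (search M) (St r2 i2 (sim_rows s m a2 b 0) 0 C 0 []) (St r' i' W' 0 C' 0 [])"
    "ro r' = dec ans" "C' = C \<or> (\<forall>l < m. \<not> good (col m c l C)) \<and> (\<exists>\<tau>. C' = put_col m (m - 1) \<tau> C)"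
    using exec_search[OF C m_pos 2(2) rf2 _ 2(4), of a2 b "[]"] by blast
  have 4: "exec x (Prim (\<lambda>r i w b. (r, w, b, Stay, Stay, Stay, Some (ro r)))) (St r' i' W' 0 C' 0 [])
      (St r' (min i' (length x + 1)) W' 0 C' 0 [dec ans])"
    using 3(2) by (intro exec_Prim) simp
  show ?thesis unfolding main_def
    using exec_Seq[OF 1 exec_Seq[OF 2(1) exec_Seq[OF 3(1) 4]]] 3(3) by blast
qed

end

lemma hamming_put_col:
  assumes "length C = c * m"
  shows "hamming C (put_col m j \<tau> C) \<le> c"
proof -
  have "{i. i < length C \<and> C ! i \<noteq> put_col m j \<tau> C ! i} \<subseteq> (\<lambda>p. p * m + j) ` {..<c}"
  proof
    fix i assume "i \<in> {i. i < length C \<and> C ! i \<noteq> put_col m j \<tau> C ! i}"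
    then have i: "i < c * m" "i mod m = j" using assms by (auto simp: put_col_def split: if_splits)
    then have "i = i div m * m + j" "i div m < c" by (auto simp: less_mult_imp_div_less)
    then show "i \<in> (\<lambda>p. p * m + j) ` {..<c}" by blast
  qed
  then have "hamming C (put_col m j \<tau> C) \<le> card ((\<lambda>p. p * m + j) ` {..<c})"
    unfolding hamming_def by (intro card_mono) auto
  also have "\<dots> \<le> c" using card_image_le[of "{..<c}"] by simp
  finally show ?thesis .
qed

lemma card_all_columns:
  assumes "0 < m"
  shows "card {C. length C = c * m \<and> (\<forall>l < m. col m c l C \<in> B)} \<le> card {\<tau> \<in> B. length \<tau> = c} ^ m"
proof -
  let ?f = "\<lambda>C. map (\<lambda>l. col m c l C) [0..<m]" and ?B = "{\<tau> \<in> B. length \<tau> = c}"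
  have fin: "finite ?B"
    by (rule finite_subset[OF _ finite_lists_length_eq[of "UNIV :: bool set" c]]) auto
  have "inj_on ?f {C. length C = c * m \<and> (\<forall>l < m. col m c l C \<in> B)}"
  proof (rule inj_onI)
    fix C D assume a: "C \<in> {C. length C = c * m \<and> (\<forall>l < m. col m c l C \<in> B)}"
      "D \<in> {C. length C = c * m \<and> (\<forall>l < m. col m c l C \<in> B)}" "?f C = ?f D"
    show "C = D"
    proof (rule nth_equalityI)
      fix i assume "i < length C"
      then have i: "i < c * m" using a by simp
      then have "i mod m < m" "i div m < c" using assms by (auto simp: less_mult_imp_div_less)
      then have "col m c (i mod m) C ! (i div m) = col m c (i mod m) D ! (i div m)"
        using a(3) by simp
      then show "C ! i = D ! i" using \<open>i div m < c\<close> by (simp add: col_def)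
    qed (use a in simp)
  qed
  then have "card {C. length C = c * m \<and> (\<forall>l < m. col m c l C \<in> B)} =
      card (?f ` {C. length C = c * m \<and> (\<forall>l < m. col m c l C \<in> B)})"
    by (rule card_image[symmetric])
  also have "\<dots> \<le> card {xs. set xs \<subseteq> ?B \<and> length xs = m}"
    using fin by (intro card_mono finite_lists_length_eq) auto
  also have "\<dots> = card ?B ^ m" by (rule card_lists_length_eq[OF fin])
  finally show ?thesis .
qed

section \<open>Short inputs\<close>

text \<open>The simulation needs \<open>4 \<le> s n\<close>, which holds for \<open>9 \<le> n\<close>; shorter inputs are hardcoded.\<close>

definition read_prefix :: "regs prog" where
  "read_prefix = move Rgt Stay Stay ;; While (\<lambda>r i w b. i \<noteq> None \<and> length (rp r) < 9)
     (Prim (\<lambda>r i w b. (r\<lparr>rp := take 9 (rp r @ [the i])\<rparr>, w, b, Rgt, Stay, Stay, None)))"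

lemma exec_read_prefix:
  assumes "0 < length W" "rp r = []"
  shows "\<exists>i. i \<le> length x + 1 \<and> exec x read_prefix (St r 0 W 0 C 0 y) (St (r\<lparr>rp := take 9 x\<rparr>) i W 0 C 0 y)"
proof -
  let ?P = "Prim (\<lambda>r i w b. (r\<lparr>rp := take 9 (rp r @ [the i])\<rparr>, w, b, Rgt, Stay, Stay, None))"
  have "\<exists>i. i \<le> length x + 1 \<and> exec x (While (\<lambda>r i w b. i \<noteq> None \<and> length (rp r) < 9) ?P)
      (St (r\<lparr>rp := take t x\<rparr>) (Suc t) W 0 C 0 y) (St (r\<lparr>rp := take 9 x\<rparr>) i W 0 C 0 y)"
    if "t \<le> 9" "t \<le> length x" for t
    using that
  proof (induction "9 - t" arbitrary: t)
    case 0
    then have t: "t = 9" by simp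
    then have "\<not> test x (\<lambda>r i w b. i \<noteq> None \<and> length (rp r) < 9) (St (r\<lparr>rp := take t x\<rparr>) (Suc t) W 0 C 0 y)"
      using 0 by simp
    from exec_WhileF[OF this] show ?case using t 0 by (intro exI[of _ "Suc t"]) simp
  next
    case (Suc n)
    show ?case
    proof (cases "t < length x")
      case True
      have tst: "test x (\<lambda>r i w b. i \<noteq> None \<and> length (rp r) < 9) (St (r\<lparr>rp := take t x\<rparr>) (Suc t) W 0 C 0 y)"
        using True Suc.hyps(2) by (simp add: inp_def)
      have 1: "exec x ?P (St (r\<lparr>rp := take t x\<rparr>) (Suc t) W 0 C 0 y) (St (r\<lparr>rp := take (Suc t) x\<rparr>) (Suc (Suc t)) W 0 C 0 y)"
        using True Suc.hyps(2) by (intro exec_Prim) (simp add: inp_def take_Suc_conv_app_nth min.absorb1)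
      have "n = 9 - Suc t" "Suc t \<le> 9" using Suc.hyps(2) by auto
      from Suc.hyps(1)[OF this] True exec_WhileT[OF tst 1] show ?thesis by auto
    next
      case False
      then have t: "t = length x" using Suc.prems by simp
      then have "\<not> test x (\<lambda>r i w b. i \<noteq> None \<and> length (rp r) < 9) (St (r\<lparr>rp := take t x\<rparr>) (Suc t) W 0 C 0 y)"
        by (simp add: inp_def)
      from exec_WhileF[OF this] show ?thesis using t Suc.prems by (intro exI[of _ "Suc t"]) simp
    qed
  qed
  from this[of 0] obtain i where i: "i \<le> length x + 1"
    "exec x (While (\<lambda>r i w b. i \<noteq> None \<and> length (rp r) < 9) ?P)
      (St (r\<lparr>rp := []\<rparr>) (Suc 0) W 0 C 0 y) (St (r\<lparr>rp := take 9 x\<rparr>) i W 0 C 0 y)"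
    by auto
  have "r\<lparr>rp := []\<rparr> = r" using assms(2) by (cases r) simp
  then have "exec x (move Rgt Stay Stay) (St r 0 W 0 C 0 y) (St (r\<lparr>rp := []\<rparr>) (Suc 0) W 0 C 0 y)"
    using exec_move[of x Rgt Stay Stay r 0 W 0 C 0 y] by simp
  from exec_Seq[OF this i(2)] show ?thesis using i(1) unfolding read_prefix_def by blast
qed

definition solver :: "mach \<Rightarrow> (bool list \<Rightarrow> bool) \<Rightarrow> regs prog" where
  "solver M L = read_prefix ;; Cond (\<lambda>r i w b. length (rp r) < 9)
     (Prim (\<lambda>r i w b. (r, w, b, Stay, Stay, Stay, Some (dec (L (rp r)))))) (main M)"

definition regs0 :: regs where
  "regs0 = \<lparr>rq = 0, rb = False, rw = Stay, rc = Stay, ro = Bot, ru = False, rv = False, rr = False,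
     rf = False, rp = []\<rparr>"

definition reg_set :: "mach \<Rightarrow> regs set" where
  "reg_set M = {r. rq r < nst M \<and> length (rp r) \<le> 9}"

lemma UNIV_out: "(UNIV :: out set) = {O0, O1, Bot}"
  using out.exhaust by auto

lemma finite_reg_set: "finite (reg_set M)"
proof -
  let ?f = "\<lambda>(q, b, w, c, y, u, v, z, f, p). \<lparr>rq = q, rb = b, rw = w, rc = c, ro = y, ru = u, rv = v, rr = z, rf = f, rp = p\<rparr>"
  let ?X = "{..<nst M} \<times> (UNIV :: bool set) \<times> (UNIV :: dir set) \<times> (UNIV :: dir set) \<times> (UNIV :: out set) \<times>
    (UNIV :: bool set) \<times> (UNIV :: bool set) \<times> (UNIV :: bool set) \<times> (UNIV :: bool set) \<times> {p :: bool list. length p \<le> 9}"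
  have "finite {p :: bool list. length p \<le> 9}"
    using finite_lists_length_le[of "UNIV :: bool set" 9] by simp
  then have "finite ?X" by (simp add: UNIV_out)
  moreover have "reg_set M \<subseteq> ?f ` ?X"
  proof
    fix r assume r: "r \<in> reg_set M"
    have "r = ?f (rq r, rb r, rw r, rc r, ro r, ru r, rv r, rr r, rf r, rp r)" by simp
    moreover have "(rq r, rb r, rw r, rc r, ro r, ru r, rv r, rr r, rf r, rp r) \<in> ?X"
      using r by (simp add: reg_set_def)
    ultimately show "r \<in> ?f ` ?X" by (rule image_eqI)
  qed
  ultimately show ?thesis using finite_surj by blast
qed

lemma prims_in_solver:
  assumes "wf_mach M"
  shows "prims_in (reg_set M) (solver M L)"
proof -
  have core: "prims_in (reg_set M) (sim_core M)"
    using assms unfolding sim_core_def wf_mach_def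
    by (auto simp: reg_set_def split: prod.splits) (metis fst_conv)
  have n: "0 < nst M" using assms by (simp add: wf_mach_def)
  have basic: "prims_in (reg_set M) (move d1 d2 d3)" "prims_in (reg_set M) (edit_row g d)"
    "prims_in (reg_set M) (put h d)" "prims_in (reg_set M) skip" for d1 d2 d3 g d h
    by (simp_all add: move_def edit_row_def put_def skip_def)
  have loops: "prims_in (reg_set M) (scan P d)" "prims_in (reg_set M) rewind" for P d
    by (simp_all add: scan_def rewind_def basic)
  have walks: "prims_in (reg_set M) (jump d)" "prims_in (reg_set M) (stride d)" "prims_in (reg_set M) (stride_pred d)" for d
    by (simp_all add: jump_def stride_def stride_pred_def basic loops)
  have right: "prims_in (reg_set M) row_right" by (simp add: row_right_def walks)
  have ends: "prims_in (reg_set M) (to_end d p)" if "prims_in (reg_set M) p" for d p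
    using that by (simp add: to_end_def probe_def unprobe_def unprobe_end_def basic) (simp add: reg_set_def)
  have inc: "prims_in (reg_set M) increment" by (simp add: increment_def basic loops)
  have "prims_in (reg_set M) (run M)"
    using n by (simp add: run_def input_rewind_def clear_A_def sim_step_def cat_move_def work_move_def
      basic loops walks right ends core) (simp add: reg_set_def)
  moreover have "prims_in (reg_set M) advance"
    by (simp add: advance_def inc_col_def clear_msb_def basic loops walks right ends) (simp add: reg_set_def)
  moreover have "prims_in (reg_set M) setup_rows"
    by (simp add: setup_rows_def init_rows_def basic loops ends inc)
  ultimately show ?thesis
    by (simp add: solver_def read_prefix_def main_def search_def basic) (auto simp: reg_set_def min_def)
qed

section \<open>The number of columns\<close>

definition ncols :: "nat \<Rightarrow> nat" where
  "ncols c = (LEAST m. 1 \<le> m \<and> c * m < 2 ^ m)"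

lemma ncols: "1 \<le> ncols c" "c * ncols c < 2 ^ ncols c"
proof -
  have "c * (2 * Suc c) < 2 ^ (2 * Suc c)"
  proof -
    have "c * 2 < (2::nat) ^ Suc c" "Suc c < (2::nat) ^ Suc c"
      using less_exp[of c] less_exp[of "Suc c"] by simp_all
    then have "c * 2 * Suc c < 2 ^ Suc c * 2 ^ Suc c" by (intro mult_strict_mono) auto
    also have "\<dots> = 2 ^ (2 * Suc c)" by (simp only: mult_2 power_add)
    finally show ?thesis by (simp only: mult_ac)
  qed
  then have "1 \<le> 2 * Suc c \<and> c * (2 * Suc c) < 2 ^ (2 * Suc c)" by simp
  from LeastI[of "\<lambda>m. 1 \<le> m \<and> c * m < 2 ^ m", OF this]
  show "1 \<le> ncols c" "c * ncols c < 2 ^ ncols c" unfolding ncols_def by simp_all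
qed

lemma ncols_le: "1 \<le> m \<Longrightarrow> c * m < 2 ^ m \<Longrightarrow> ncols c \<le> m"
  unfolding ncols_def by (intro Least_le) simp

lemma ncols_ge_2: "2 \<le> c \<Longrightarrow> 2 \<le> ncols c"
proof (rule ccontr)
  assume c: "2 \<le> c" "\<not> 2 \<le> ncols c"
  then have "ncols c = 1" using ncols(1)[of c] by linarith
  then show False using ncols(2)[of c] c(1) by simp
qed

lemma ncols_pred: "2 \<le> c \<Longrightarrow> 2 ^ (ncols c - 1) \<le> c * (ncols c - 1)"
proof (rule ccontr)
  assume c: "2 \<le> c" and "\<not> 2 ^ (ncols c - 1) \<le> c * (ncols c - 1)"
  then have "ncols c \<le> ncols c - 1" using ncols_ge_2[OF c] by (intro ncols_le) auto
  then show False using ncols_ge_2[OF c] by linarith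
qed

lemma ncols_less:
  assumes "4 \<le> s" "c \<le> 2 ^ s"
  shows "ncols c < 2 * s"
proof -
  have p: "2 * s - 1 < 2 ^ (s - 1)"
    using assms(1)
  proof (induction s rule: nat_induct_at_least)
    case (Suc s)
    have "2 * Suc s - 1 = 2 * s + 1" by simp
    also have "\<dots> < 2 * 2 ^ (s - 1)" using Suc by linarith
    also have "\<dots> = 2 ^ (Suc s - 1)" using Suc.hyps by (cases s) auto
    finally show ?case .
  qed simp
  have "c * (2 * s - 1) \<le> 2 ^ s * (2 * s - 1)" using assms(2) by (intro mult_le_mono1)
  also have "\<dots> < 2 ^ s * 2 ^ (s - 1)" using p by simp
  also have "\<dots> = 2 ^ (2 * s - 1)" using assms(1) by (simp flip: power_add)
  finally have "ncols c \<le> 2 * s - 1" using assms(1) by (intro ncols_le) auto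
  then show ?thesis using assms(1) by linarith
qed

lemma square_le_exp: "(t::nat)\<^sup>2 \<le> 4 * 2 ^ t"
proof (cases "t < 4")
  case True
  then have "t = 0 \<or> t = 1 \<or> t = 2 \<or> t = 3" by auto
  then show ?thesis by auto
next
  case False
  then have "4 \<le> t" by simp
  then show ?thesis
  proof (induction t rule: nat_induct_at_least)
    case (Suc t)
    have "4 * t \<le> t * t" using Suc by simp
    moreover have "(Suc t)\<^sup>2 = t * t + 2 * t + 1" "t\<^sup>2 = t * t" by (simp_all add: power2_eq_square)
    moreover have "(2::nat) ^ Suc t = 2 * 2 ^ t" by simp
    ultimately show ?case using Suc by linarith
  qed simp
qed

lemma ncols_le_log:
  assumes "4 \<le> c"
  shows "real (ncols c) \<le> 4 * log 2 (real c)"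
proof -
  define t where "t = ncols c - 1"
  have t: "2 ^ t \<le> c * t" using ncols_pred[of c] assms by (simp add: t_def)
  have "2 ^ t * 2 ^ t \<le> (c * t) * (c * t)" using t by (intro mult_le_mono)
  also have "\<dots> = c\<^sup>2 * t\<^sup>2" by (simp add: power2_eq_square)
  also have "\<dots> \<le> c\<^sup>2 * (4 * 2 ^ t)" using square_le_exp by (intro mult_le_mono2)
  finally have "2 ^ t * 2 ^ t \<le> (4 * c\<^sup>2) * 2 ^ t" by (simp add: mult_ac)
  then have le: "2 ^ t \<le> 4 * c\<^sup>2" by simp
  have l4: "log 2 4 = (2::real)" using log_pow_cancel[of 2 2] by simp
  have "real t = log 2 (2 ^ t)" by simp
  also have "\<dots> \<le> log 2 (4 * (real c)\<^sup>2)"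
  proof -
    have "real (2 ^ t) \<le> real (4 * c\<^sup>2)" using le by (rule of_nat_mono)
    then show ?thesis using assms by (intro log_mono) auto
  qed
  also have "\<dots> = 2 + 2 * log 2 (real c)" using assms l4 by (simp add: log_mult log_nat_power)
  finally have "real t \<le> 2 + 2 * log 2 (real c)" .
  moreover have "real (ncols c) = real t + 1" using ncols(1)[of c] by (simp add: t_def)
  moreover have "2 \<le> log 2 (real c)" using log_mono[of 2 4 "real c"] assms l4 by simp
  ultimately show ?thesis by linarith
qed

section \<open>Expected distance\<close>

lemma card_bool_lists: "card {\<tau> :: bool list. length \<tau> = n} = 2 ^ n" "finite {\<tau> :: bool list. length \<tau> = n}"
  using card_lists_length_eq[of "UNIV :: bool set" n] finite_lists_length_eq[of "UNIV :: bool set" n] by simp_all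

lemma average_hamming_le:
  fixes F :: "bool list \<Rightarrow> bool list"
  assumes c: "0 < c" "0 < m" and half: "2 ^ c \<le> 2 * card {\<tau>. length \<tau> = c \<and> P \<tau>}"
    and F: "\<And>C. length C = c * m \<Longrightarrow> F C = C \<or> (\<forall>l < m. \<not> P (col m c l C)) \<and> (\<exists>\<tau>. F C = put_col m j \<tau> C)"
  shows "(\<Sum>C\<in>{C. length C = c * m}. real (hamming C (F C))) / 2 ^ (c * m) \<le> real c / 2 ^ m"
proof -
  let ?B = "{\<tau>. \<not> P \<tau>}"
  let ?Z = "{C. length C = c * m \<and> (\<forall>l < m. col m c l C \<in> ?B)}"
  let ?A = "{\<tau>. length \<tau> = c \<and> P \<tau>}" and ?B' = "{\<tau> \<in> ?B. length \<tau> = c}"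
  have "finite ?A" "finite ?B'"
    by (rule finite_subset[OF _ card_bool_lists(2)[of c]]; blast)+
  then have "card (?A \<union> ?B') = card ?A + card ?B'" by (intro card_Un_disjoint) auto
  moreover have "?A \<union> ?B' = {\<tau>. length \<tau> = c}" by blast
  ultimately have "2 ^ c = card ?A + card ?B'" using card_bool_lists(1)[of c] by simp
  moreover have "(2::nat) ^ c = 2 * 2 ^ (c - 1)" using c(1) by (metis Suc_pred' power_Suc)
  ultimately have "card ?B' \<le> 2 ^ (c - 1)" using half by linarith
  then have "card ?Z \<le> (2 ^ (c - 1)) ^ m"
    using card_all_columns[OF c(2), of c ?B] power_mono[of "card {\<tau> \<in> ?B. length \<tau> = c}" "2 ^ (c - 1)" m]
    by linarith
  then have "real (card ?Z) \<le> real ((2 ^ (c - 1)) ^ m)" by (rule of_nat_mono)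
  then have Z: "real (card ?Z) \<le> (2 ^ (c - 1)) ^ m" by simp
  have ham: "real (hamming C (F C)) \<le> (if C \<in> ?Z then real c else 0)" if "length C = c * m" for C
    using F[OF that]
  proof
    assume "F C = C"
    then show ?thesis by (simp add: hamming_def)
  next
    assume a: "(\<forall>l < m. \<not> P (col m c l C)) \<and> (\<exists>\<tau>. F C = put_col m j \<tau> C)"
    then obtain \<tau> where "F C = put_col m j \<tau> C" by blast
    then have "hamming C (F C) \<le> c" using hamming_put_col[OF that] by simp
    then show ?thesis using a that by simp
  qed
  have "(\<Sum>C\<in>{C. length C = c * m}. real (hamming C (F C))) \<le> (\<Sum>C\<in>{C. length C = c * m}. if C \<in> ?Z then real c else 0)"
    using ham by (intro sum_mono) auto
  also have "\<dots> = (\<Sum>C\<in>{C. length C = c * m} \<inter> ?Z. real c)"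
    by (rule sum.inter_restrict[symmetric, OF card_bool_lists(2)])
  also have "{C. length C = c * m} \<inter> ?Z = ?Z" by blast
  also have "(\<Sum>C\<in>?Z. real c) = real (card ?Z) * real c" by simp
  also have "\<dots> \<le> (2 ^ (c - 1)) ^ m * real c" using Z by (intro mult_right_mono) auto
  finally have le: "(\<Sum>C\<in>{C. length C = c * m}. real (hamming C (F C))) \<le> (2 ^ (c - 1)) ^ m * real c" .
  have "(2::real) ^ c = 2 * 2 ^ (c - 1)" using c(1) by (metis Suc_pred' power_Suc)
  then have "(2::real) ^ (c * m) = 2 ^ m * (2 ^ (c - 1)) ^ m" by (simp add: power_mult power_mult_distrib)
  then have "(2 ^ (c - 1)) ^ m * real c / 2 ^ (c * m) = real c / 2 ^ m" by simp
  then show ?thesis using divide_right_mono[OF le, of "2 ^ (c * m)"] by simp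
qed

theorem theorem6p5:
  fixes s c :: "nat \<Rightarrow> nat"
  assumes "mono s" and "mono c"
    and "logspace_constructible s" and "logspace_constructible c"
    and "\<forall>n. log 2 (real n) \<le> real (s n)"
    and "\<forall>n. s n \<le> c n" and "\<forall>n. c n \<le> 2 ^ s n"
  shows "\<forall>L \<in> ZP_CSPACE s c. \<exists>s' c' (e :: nat \<Rightarrow> real).
           (\<lambda>n. real (s' n)) \<in> O(\<lambda>n. real (s n)) \<and>
           (\<lambda>n. real (c' n)) \<in> O(\<lambda>n. real (c n) * log 2 (real (c n))) \<and>
           e \<in> o(\<lambda>n. 1) \<and>
           L \<in> AVG_LCSPACE s' c' e"
proof
  fix L assume "L \<in> ZP_CSPACE s c"
  then obtain M where wf: "wf_mach M"
    and M: "\<And>x \<tau>. length \<tau> = c (length x) \<Longrightarrow> halts M x (s (length x)) \<tau> \<and>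
        ct (final M x (s (length x)) \<tau>) = \<tau> \<and> ot (final M x (s (length x)) \<tau>) \<in> {[dec (L x)], [Bot]}"
    and half: "\<And>x. 2 ^ c (length x) \<le>
        2 * card {\<tau>. length \<tau> = c (length x) \<and> ot (final M x (s (length x)) \<tau>) = [dec (L x)]}"
    unfolding ZP_CSPACE_def by blast
  have large: "4 \<le> s n" "4 \<le> c n" if "9 \<le> n" for n
  proof -
    have "(3::real) = log 2 8" using log_pow_cancel[of 2 3] by simp
    also have "\<dots> < log 2 (real n)" using that by simp
    also have "\<dots> \<le> real (s n)" using assms(5) by simp
    finally show "4 \<le> s n" by simp
    then show "4 \<le> c n" using assms(6) le_trans by blast
  qed
  define m where "m n = ncols (c n)" for n
  define s' where "s' n = ntracks * (2 * max 1 (s n))" for n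
  define c' where "c' n = c n * m n" for n
  define e where "e n = (if n < 9 then 0 else real (c n) / 2 ^ m n)" for n
  have sol: "prims_in (reg_set M) (solver M L)" by (rule prims_in_solver[OF wf])
  have r0: "regs0 \<in> reg_set M" using wf by (simp add: regs0_def reg_set_def wf_mach_def)
  obtain N where N: "wf_mach N" and run: "\<And>x n \<tau> r i W h C k y. 0 < n \<Longrightarrow>
      exec x (solver M L) (St regs0 0 (replicate n blank_row) 0 \<tau> 0 []) (St r i W h C k y) \<Longrightarrow>
      halts N x (ntracks * n) \<tau> \<and> ct (final N x (ntracks * n) \<tau>) = C \<and> ot (final N x (ntracks * n) \<tau>) = y"
    using program_to_machine[OF finite_reg_set r0 sol] by metis
  have short: "halts N x (s' (length x)) \<tau> \<and> ct (final N x (s' (length x)) \<tau>) = \<tau> \<and>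
      ot (final N x (s' (length x)) \<tau>) = [dec (L x)]" if "length x < 9" for x \<tau>
  proof -
    let ?n = "2 * max 1 (s (length x))" and ?r = "regs0\<lparr>rp := take 9 x\<rparr>"
    obtain i where i: "i \<le> length x + 1"
      "exec x read_prefix (St regs0 0 (replicate ?n blank_row) 0 \<tau> 0 []) (St ?r i (replicate ?n blank_row) 0 \<tau> 0 [])"
      using exec_read_prefix[of "replicate ?n blank_row" regs0 x \<tau> "[]"] by (auto simp: regs0_def less_max_iff_disj)
    have t: "test x (\<lambda>r i w b. length (rp r) < 9) (St ?r i (replicate ?n blank_row) 0 \<tau> 0 [])"
      using that by simp
    have "exec x (Prim (\<lambda>r i w b. (r, w, b, Stay, Stay, Stay, Some (dec (L (rp r))))))
        (St ?r i (replicate ?n blank_row) 0 \<tau> 0 []) (St ?r i (replicate ?n blank_row) 0 \<tau> 0 [dec (L x)])"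
      using that i(1) by (intro exec_Prim) (simp del: nth_replicate)
    then have "exec x (solver M L) (St regs0 0 (replicate ?n blank_row) 0 \<tau> 0 [])
        (St ?r i (replicate ?n blank_row) 0 \<tau> 0 [dec (L x)])"
      unfolding solver_def by (intro exec_Seq[OF i(2)] exec_IfT[OF t])
    from run[OF _ this] show ?thesis by (simp add: s'_def)
  qed
  have long: "halts N x (s' (length x)) \<tau> \<and> ot (final N x (s' (length x)) \<tau>) = [dec (L x)] \<and>
      (ct (final N x (s' (length x)) \<tau>) = \<tau> \<or>
        (\<forall>l < m (length x). ot (final M x (s (length x)) (col (m (length x)) (c (length x)) l \<tau>)) \<noteq> [dec (L x)]) \<and>
        (\<exists>\<sigma>. ct (final N x (s' (length x)) \<tau>) = put_col (m (length x)) (m (length x) - 1) \<sigma> \<tau>))"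
    if x: "9 \<le> length x" and \<tau>: "length \<tau> = c' (length x)" for x \<tau>
  proof -
    let ?s = "s (length x)" and ?c = "c (length x)" and ?m = "m (length x)"
    note lg = large[OF x]
    interpret zero_error x ?s ?c ?m M "L x"
    proof
      show "0 < ?s" "0 < ?c" using lg by simp_all
      show "2 \<le> ?m" using lg ncols_ge_2 by (simp add: m_def)
      show "?m < 2 * ?s" using lg assms(7) ncols_less by (simp add: m_def)
    qed (use M half in auto)
    let ?r = "regs0\<lparr>rp := take 9 x\<rparr>" and ?W = "replicate (2 * ?s) blank_row"
    obtain i where i: "i \<le> length x + 1"
      "exec x read_prefix (St regs0 0 ?W 0 \<tau> 0 []) (St ?r i ?W 0 \<tau> 0 [])"
      using exec_read_prefix[of ?W regs0 x \<tau> "[]"] lg by (auto simp: regs0_def)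
    have t: "\<not> test x (\<lambda>r i w b. length (rp r) < 9) (St ?r i ?W 0 \<tau> 0 [])"
      using x by simp
    have T: "?c * ?m < 2 ^ ?m" "2 ^ (?m - 1) \<le> ?c * ?m"
    proof -
      show "?c * ?m < 2 ^ ?m" using ncols by (simp add: m_def)
      have "2 ^ (?m - 1) \<le> ?c * (?m - 1)" using ncols_pred lg by (simp add: m_def)
      also have "\<dots> \<le> ?c * ?m" by simp
      finally show "2 ^ (?m - 1) \<le> ?c * ?m" .
    qed
    have "\<not> rf ?r" by (simp add: regs0_def)
    from exec_main[OF T _ i(1) this] obtain r' i' W' h' C' k' where
      ex: "exec x (main M) (St ?r i ?W 0 \<tau> 0 []) (St r' i' W' h' C' k' [dec (L x)])"
      and C': "C' = \<tau> \<or> (\<forall>l < ?m. \<not> good (col ?m ?c l \<tau>)) \<and> (\<exists>\<sigma>. C' = put_col ?m (?m - 1) \<sigma> \<tau>)"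
      using \<tau> by (metis c'_def)
    have "exec x (solver M L) (St regs0 0 ?W 0 \<tau> 0 []) (St r' i' W' h' C' k' [dec (L x)])"
      unfolding solver_def by (intro exec_Seq[OF i(2)] exec_IfF[OF t] ex)
    from run[OF _ this] C' show ?thesis using lg by (simp add: s'_def max_def good_def)
  qed
  have "L \<in> AVG_LCSPACE s' c' e"
    unfolding AVG_LCSPACE_def
  proof (intro CollectI exI[of _ N] conjI allI impI N)
    fix x \<tau> :: "bool list" assume "length \<tau> = c' (length x)"
    then show "halts N x (s' (length x)) \<tau>" "ot (final N x (s' (length x)) \<tau>) = [dec (L x)]"
      using short[of x \<tau>] long[of x \<tau>] by (cases "length x < 9"; simp)+
  next
    fix x
    show "(\<Sum>\<tau>\<in>{\<tau>. length \<tau> = c' (length x)}. real (hamming \<tau> (ct (final N x (s' (length x)) \<tau>))))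
       / 2 ^ c' (length x) \<le> e (length x)"
    proof (cases "length x < 9")
      case True
      then show ?thesis using short by (simp add: e_def hamming_def)
    next
      case False
      then have x: "9 \<le> length x" by simp
      show ?thesis
        using average_hamming_le[OF _ _ half[of x], of "m (length x)" "\<lambda>\<tau>. ct (final N x (s' (length x)) \<tau>)" "m (length x) - 1"]
          long[OF x] large[OF x] ncols(1)[of "c (length x)"] False
        by (simp add: e_def c'_def m_def)
    qed
  qed
  moreover have "(\<lambda>n. real (s' n)) \<in> O(\<lambda>n. real (s n))"
  proof (rule bigoI[of _ 14], rule eventually_sequentiallyI[of 9])
    fix n :: nat assume "9 \<le> n"
    then show "norm (real (s' n)) \<le> 14 * norm (real (s n))"
      using large[of n] by (simp add: s'_def ntracks_def max_def)
  qed
  moreover have "(\<lambda>n. real (c' n)) \<in> O(\<lambda>n. real (c n) * log 2 (real (c n)))"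
  proof (rule bigoI[of _ 4], rule eventually_sequentiallyI[of 9])
    fix n :: nat assume n: "9 \<le> n"
    have "real (c n) * real (m n) \<le> real (c n) * (4 * log 2 (real (c n)))"
      using ncols_le_log[OF large(2)[OF n]] by (intro mult_left_mono) (auto simp: m_def)
    moreover have "0 \<le> log 2 (real (c n))" using large[OF n] by simp
    ultimately show "norm (real (c' n)) \<le> 4 * norm (real (c n) * log 2 (real (c n)))"
      by (simp add: c'_def abs_mult mult_ac)
  qed
  moreover have "e \<in> o(\<lambda>n. 1)"
  proof (rule landau_o.smallI)
    fix \<epsilon> :: real assume \<epsilon>: "0 < \<epsilon>"
    obtain K :: nat where K: "1 / \<epsilon> < real K" using reals_Archimedean2 by blast
    show "\<forall>\<^sub>F n in sequentially. norm (e n) \<le> \<epsilon> * norm (1::real)"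
    proof (rule eventually_sequentiallyI[of "max 9 (2 ^ (2 ^ K))"])
      fix n :: nat assume n: "max 9 (2 ^ (2 ^ K)) \<le> n"
      then have n9: "9 \<le> n" and "(2::nat) ^ (2 ^ K) \<le> n" by simp_all
      then have "(2::real) ^ (2 ^ K) \<le> real n" by (metis of_nat_le_iff of_nat_numeral of_nat_power)
      then have "log 2 ((2::real) ^ (2 ^ K)) \<le> log 2 (real n)" by (intro log_mono) auto
      then have "real (2 ^ K) \<le> log 2 (real n)" by simp
      also have "\<dots> \<le> real (s n)" using assms(5) by blast
      finally have "real (2 ^ K) \<le> real (s n)" .
      then have "2 ^ K \<le> c n" using assms(6) le_trans by (metis of_nat_le_iff)
      also have "\<dots> \<le> c n * m n" using ncols(1) by (simp add: m_def)
      also have "\<dots> < 2 ^ m n" using ncols(2) by (simp add: m_def)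
      finally have "K < m n" by simp
      then have "1 / \<epsilon> < real (m n)" using K by simp
      then have m1: "1 \<le> \<epsilon> * real (m n)" using \<epsilon> by (simp add: field_simps)
      have "real (c n * m n) < real (2 ^ m n)" using ncols(2) by (simp only: m_def of_nat_less_iff)
      then have cm: "real (c n) * real (m n) < 2 ^ m n" by simp
      have "real (c n) * 1 \<le> real (c n) * (\<epsilon> * real (m n))" using m1 by (intro mult_left_mono) auto
      also have "\<dots> = \<epsilon> * (real (c n) * real (m n))" by simp
      also have "\<dots> \<le> \<epsilon> * 2 ^ m n" using cm \<epsilon> by (intro mult_left_mono) auto
      finally show "norm (e n) \<le> \<epsilon> * norm (1::real)" using n9 by (simp add: e_def field_simps)
    qed
  qed
  ultimately show "\<exists>s' c' (e :: nat \<Rightarrow> real). (\<lambda>n. real (s' n)) \<in> O(\<lambda>n. real (s n)) \<and>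
           (\<lambda>n. real (c' n)) \<in> O(\<lambda>n. real (c n) * log 2 (real (c n))) \<and>
           e \<in> o(\<lambda>n. 1) \<and> L \<in> AVG_LCSPACE s' c' e"
    by blast
qed

end
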